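(* Let $X$ and $Y$ be Banach spaces (both real or both complex) and let $S\colon X\to Y$ be a bounded linear operator. Then for all real $\alpha>0$ and all $n\in\mathbb{N}=\{1,2,\dots\}$, $$c_n(S) \;\le\; e^\alpha\, n^{-\alpha+1}\cdot \sup_{1\le k\le n}\, k^\alpha\, h_k(S),$$ and $$a_n(S) \;\le\; 2\,e^\alpha\, n^{-\alpha+3/2}\cdot \sup_{1\le k\le n}\, k^\alpha\, h_k(S),$$ where $a_n(S)$, $c_n(S)$ and $h_k(S)$ denote the approximation, Gelfand and Hilbert numbers of $S$, respectively.
   Context: All Banach spaces are real or complex (over a common scalar field). $\mathcal{L}(X,Y)$ denotes the bounded linear operators from $X$ to $Y$ with the operator norm $\|\cdot\|$; $\operatorname{rank}(L):=\dim(L(X))$ for $L\in\mathcal{L}(X,Y)$. For a closed subspace $M\subset X$, $J_M^X\colon M\to X$, $J_M^X(x)=x$, is the embedding, and $\operatorname{codim}(M):=\dim(X/M)$. $\ell_2$ is the Hilbert space of square-summable sequences indexed by $\mathbb{N}$ over the same scalar field. For $S\in\mathcal{L}(X,Y)$ and $n\in\mathbb{N}=\{1,2,\dots\}$: - Approximation numbers: $a_n(S):=\inf\{\|S-L\| : L\in\mathcal{L}(X,Y),\ \operatorname{rank}(L)<n\}$. - Gelfand numbers: $c_n(S):=\inf\{\|S J_M^X\| : M\subset X \text{ closed subspace},\ \operatorname{codim}(M)<n\}$. - Hilbert numbers: $h_n(S):=\sup\left\{\dfrac{a_n(BSA)}{\|B\|\,\|A\|} : A\in\mathcal{L}(\ell_2,X),\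 B\in\mathcal{L}(Y,\ell_2),\ A\neq0,\ B\neq 0\right\}$, where $a_n(BSA)$ is the approximation number of $BSA\in\mathcal{L}(\ell_2,\ell_2)$. (The supremum over the empty set, which occurs only if $X=\{0\}$ or $Y=\{0\}$, is $0$.) *)

theory Defs
  imports "HOL-Analysis.Analysis" "HOL-Library.Extended_Nat"
begin

section \<open>Scalars\<close>

text \<open>
  The scalar fields are \<^typ>\<open>real\<close> and \<^typ>\<open>complex\<close>: a type belongs to the following class iff it
  is isometrically isomorphic to one of the two. (The map \<open>\<lambda>r. r *\<^sub>R 1\<close>, which is \<^const>\<open>of_real\<close>,
  is always an isometric field homomorphism.)
\<close>

class real_or_complex_field = real_normed_field +
  assumes real_or_complex:
    "(\<forall>x :: 'a. \<exists>r. x = r *\<^sub>R 1) \<or>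
     (\<exists>\<phi> :: complex \<Rightarrow> 'a. bij \<phi> \<and> \<phi> 1 = 1 \<and>
        (\<forall>z w. \<phi> (z + w) = \<phi> z + \<phi> w) \<and> (\<forall>z w. \<phi> (z * w) = \<phi> z * \<phi> w) \<and>
        (\<forall>z. norm (\<phi> z) = norm z))"

instance real :: real_or_complex_field
  by standard auto

instance complex :: real_or_complex_field
  by standard (intro disjI2 exI[of _ id], simp)


section \<open>Normed spaces and operators over a scalar field\<close>

text \<open>
  The library's normed spaces are real. A normed space over \<open>'k\<close> is a real normed space with a
  compatible multiplication by scalars from \<open>'k\<close>; for \<open>'k = real\<close> this multiplication is
  \<^const>\<open>scaleR\<close>. Completeness does not depend on the scalars, so the Banach spaces over \<open>'k\<close> are the
  structures of this kind on types of class \<^class>\<open>banach\<close>.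
\<close>

locale normed_space_over = vector_space scale
  for scale :: "'k::real_or_complex_field \<Rightarrow> 'a::real_normed_vector \<Rightarrow> 'a" +
  assumes norm_scale: "norm (scale c x) = norm c * norm x"
    and scale_of_real: "scale (of_real r) x = r *\<^sub>R x"

definition bounded_operator ::
    "('k::real_or_complex_field \<Rightarrow> 'a::real_normed_vector \<Rightarrow> 'a) \<Rightarrow>
     ('k \<Rightarrow> 'b::real_normed_vector \<Rightarrow> 'b) \<Rightarrow> ('a \<Rightarrow> 'b) \<Rightarrow> bool" where
  "bounded_operator sX sY T \<longleftrightarrow> Vector_Spaces.linear sX sY T \<and> bounded_linear T"

text \<open>
  The guard is needed because \<^const>\<open>vector_space.dim\<close> is \<open>0\<close> for infinite-dimensional spaces.
\<close>

definition operator_rank ::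
    "('k::real_or_complex_field \<Rightarrow> 'b::real_normed_vector \<Rightarrow> 'b) \<Rightarrow> ('a \<Rightarrow> 'b) \<Rightarrow> enat" where
  "operator_rank sY L = (if \<exists>B. finite B \<and> range L \<subseteq> module.span sY B
                then enat (vector_space.dim sY (range L)) else \<infinity>)"

text \<open>
  For a subspace \<open>M\<close> of \<open>X\<close>, \<open>quotient_basis s M B\<close> says that the cosets \<open>b + M\<close> for \<open>b \<in> B\<close> are
  pairwise different and form a finite basis of \<open>X / M\<close>. Hence the infimum below is \<open>dim (X / M)\<close>:
  all bases have the same cardinality, and the infimum is \<open>\<infinity>\<close> if there is no finite one.
\<close>

definition quotient_basis ::
    "('k::real_or_complex_field \<Rightarrow> 'a::real_normed_vector \<Rightarrow> 'a) \<Rightarrow> 'a set \<Rightarrow> 'a set \<Rightarrow> bool" where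
  "quotient_basis s M B \<longleftrightarrow> finite B \<and>
     (\<forall>x. \<exists>c. x - (\<Sum>b\<in>B. s (c b) b) \<in> M) \<and>
     (\<forall>c. (\<Sum>b\<in>B. s (c b) b) \<in> M \<longrightarrow> (\<forall>b\<in>B. c b = 0))"

definition codim ::
    "('k::real_or_complex_field \<Rightarrow> 'a::real_normed_vector \<Rightarrow> 'a) \<Rightarrow> 'a set \<Rightarrow> enat" where
  "codim s M = (INF B\<in>{B. quotient_basis s M B}. enat (card B))"

text \<open>
  The operator norm of the restriction of \<open>T\<close> to the subspace \<open>M\<close>; as in \<^const>\<open>onorm\<close>, the point
  \<open>0\<close> contributes \<open>0 / 0 = 0\<close>.
\<close>

definition onorm_on :: "'a::real_normed_vector set \<Rightarrow> ('a \<Rightarrow> 'b::real_normed_vector) \<Rightarrow> real" where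
  "onorm_on M T = (SUP x\<in>M. norm (T x) / norm x)"


section \<open>The Hilbert space of square-summable sequences\<close>

lemma square_sum_add_bound:
  fixes x y :: "nat \<Rightarrow> 'k::real_normed_vector"
  assumes x: "summable (\<lambda>i. (norm (x i))\<^sup>2)" and y: "summable (\<lambda>i. (norm (y i))\<^sup>2)"
  shows "(\<Sum>i<n. (norm (x i + y i))\<^sup>2) \<le>
    (sqrt (\<Sum>i. (norm (x i))\<^sup>2) + sqrt (\<Sum>i. (norm (y i))\<^sup>2))\<^sup>2"
proof -
  have le: "L2_set (\<lambda>i. norm (z i)) {..<n} \<le> sqrt (\<Sum>i. (norm (z i))\<^sup>2)"
    if "summable (\<lambda>i. (norm (z i))\<^sup>2)" for z :: "nat \<Rightarrow> 'k"
    unfolding L2_set_def by (intro real_sqrt_le_mono sum_le_suminf that) auto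
  have "L2_set (\<lambda>i. norm (x i + y i)) {..<n} \<le> L2_set (\<lambda>i. norm (x i) + norm (y i)) {..<n}"
    by (intro L2_set_mono norm_triangle_ineq) auto
  also have "\<dots> \<le> L2_set (\<lambda>i. norm (x i)) {..<n} + L2_set (\<lambda>i. norm (y i)) {..<n}"
    by (rule L2_set_triangle_ineq)
  also have "\<dots> \<le> sqrt (\<Sum>i. (norm (x i))\<^sup>2) + sqrt (\<Sum>i. (norm (y i))\<^sup>2)"
    by (intro add_mono le x y)
  finally have "(L2_set (\<lambda>i. norm (x i + y i)) {..<n})\<^sup>2 \<le>
      (sqrt (\<Sum>i. (norm (x i))\<^sup>2) + sqrt (\<Sum>i. (norm (y i))\<^sup>2))\<^sup>2"
    by (intro power_mono L2_set_nonneg)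
  then show ?thesis
    by (simp add: L2_set_def sum_nonneg)
qed

lemma square_summable_add:
  fixes x y :: "nat \<Rightarrow> 'k::real_normed_vector"
  assumes "summable (\<lambda>i. (norm (x i))\<^sup>2)" and "summable (\<lambda>i. (norm (y i))\<^sup>2)"
  shows "summable (\<lambda>i. (norm (x i + y i))\<^sup>2)"
  using square_sum_add_bound[OF assms] by (intro summableI_nonneg_bounded) auto

typedef (overloaded) 'k ell2 =
    "{x :: nat \<Rightarrow> 'k::real_normed_field. summable (\<lambda>i. (norm (x i))\<^sup>2)}"
  by (rule exI[of _ "\<lambda>_. 0"]) simp

setup_lifting type_definition_ell2

instantiation ell2 :: (real_normed_field) real_normed_vector
begin

lift_definition zero_ell2 :: "'a ell2" is "\<lambda>_. 0" by simp

lift_definition plus_ell2 :: "'a ell2 \<Rightarrow> 'a ell2 \<Rightarrow> 'a ell2" is "\<lambda>x y i. x i + y i"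
  by (rule square_summable_add)

lift_definition uminus_ell2 :: "'a ell2 \<Rightarrow> 'a ell2" is "\<lambda>x i. - x i" by simp

lift_definition minus_ell2 :: "'a ell2 \<Rightarrow> 'a ell2 \<Rightarrow> 'a ell2" is "\<lambda>x y i. x i - y i"
  using square_summable_add[where y = "\<lambda>i. - y i" for y] by simp

lift_definition scaleR_ell2 :: "real \<Rightarrow> 'a ell2 \<Rightarrow> 'a ell2" is "\<lambda>r x i. r *\<^sub>R x i"
  by (simp add: power_mult_distrib summable_mult)

lift_definition norm_ell2 :: "'a ell2 \<Rightarrow> real" is "\<lambda>x. sqrt (\<Sum>i. (norm (x i))\<^sup>2)" .

definition "sgn (x :: 'a ell2) = scaleR (inverse (norm x)) x"
definition "dist (x :: 'a ell2) y = norm (x - y)"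
definition "uniformity = (INF e\<in>{0<..}. principal {(x :: 'a ell2, y). dist x y < e})"
definition "open U \<longleftrightarrow> (\<forall>x\<in>U. \<forall>\<^sub>F (x', y) in uniformity. x' = (x :: 'a ell2) \<longrightarrow> y \<in> U)"

instance
proof
  fix x y z :: "'a ell2" and r q :: real and U :: "'a ell2 set"
  show "dist x y = norm (x - y)" by (fact dist_ell2_def)
  show "sgn x = scaleR (inverse (norm x)) x" by (fact sgn_ell2_def)
  show "uniformity = (INF e\<in>{0<..}. principal {(x :: 'a ell2, y). dist x y < e})"
    by (fact uniformity_ell2_def)
  show "open U \<longleftrightarrow> (\<forall>x\<in>U. \<forall>\<^sub>F (x', y) in uniformity. x' = x \<longrightarrow> y \<in> U)"
    by (fact open_ell2_def)
  show "x + y + z = x + (y + z)" by transfer (simp add: add.assoc)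
  show "x + y = y + x" by transfer (simp add: add.commute)
  show "0 + x = x" by transfer simp
  show "- x + x = 0" by transfer simp
  show "x - y = x + - y" by transfer simp
  show "r *\<^sub>R (x + y) = r *\<^sub>R x + r *\<^sub>R y" by transfer (simp add: scaleR_add_right)
  show "(r + q) *\<^sub>R x = r *\<^sub>R x + q *\<^sub>R x" by transfer (simp add: scaleR_add_left)
  show "r *\<^sub>R q *\<^sub>R x = (r * q) *\<^sub>R x" by transfer simp
  show "1 *\<^sub>R x = x" by transfer simp
  show "norm x = 0 \<longleftrightarrow> x = 0" by transfer (auto simp: suminf_eq_zero_iff)
  show "norm (x + y) \<le> norm x + norm y"
  proof transfer
    fix x y :: "nat \<Rightarrow> 'a"
    assume x: "summable (\<lambda>i. (norm (x i))\<^sup>2)" and y: "summable (\<lambda>i. (norm (y i))\<^sup>2)"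
    have "(\<Sum>i. (norm (x i + y i))\<^sup>2) \<le>
        (sqrt (\<Sum>i. (norm (x i))\<^sup>2) + sqrt (\<Sum>i. (norm (y i))\<^sup>2))\<^sup>2"
      by (intro suminf_le_const square_summable_add square_sum_add_bound x y)
    then show "sqrt (\<Sum>i. (norm (x i + y i))\<^sup>2) \<le>
        sqrt (\<Sum>i. (norm (x i))\<^sup>2) + sqrt (\<Sum>i. (norm (y i))\<^sup>2)"
      by (intro real_le_lsqrt add_nonneg_nonneg real_sqrt_ge_zero suminf_nonneg x y) auto
  qed
  show "norm (r *\<^sub>R x) = \<bar>r\<bar> * norm x"
    by transfer (simp add: power_mult_distrib suminf_mult real_sqrt_mult)
qed

end

lift_definition scale_ell2 :: "'k::real_normed_field \<Rightarrow> 'k ell2 \<Rightarrow> 'k ell2" is "\<lambda>c x i. c * x i"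
  by (simp add: norm_mult power_mult_distrib summable_mult)

lemma normed_space_over_ell2:
  "normed_space_over (scale_ell2 :: 'k::real_or_complex_field \<Rightarrow> 'k ell2 \<Rightarrow> 'k ell2)"
proof
  fix c d :: 'k and x y :: "'k ell2" and r :: real
  show "scale_ell2 c (x + y) = scale_ell2 c x + scale_ell2 c y"
    by transfer (simp add: distrib_left)
  show "scale_ell2 (c + d) x = scale_ell2 c x + scale_ell2 d x"
    by transfer (simp add: distrib_right)
  show "scale_ell2 c (scale_ell2 d x) = scale_ell2 (c * d) x"
    by transfer (simp add: mult.assoc)
  show "scale_ell2 1 x = x" by transfer simp
  show "norm (scale_ell2 c x) = norm c * norm x"
    by transfer (simp add: norm_mult power_mult_distrib suminf_mult real_sqrt_mult)
  show "scale_ell2 (of_real r) x = r *\<^sub>R x"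
    by transfer (simp add: scaleR_conv_of_real)
qed


section \<open>Approximation, Gelfand and Hilbert numbers\<close>

text \<open>
  The sets of which infima are taken are nonempty only for \<open>n \<ge> 1\<close>; the value at \<open>n = 0\<close> has no
  meaning.
\<close>

definition approximation_number ::
    "('k::real_or_complex_field \<Rightarrow> 'a::real_normed_vector \<Rightarrow> 'a) \<Rightarrow>
     ('k \<Rightarrow> 'b::real_normed_vector \<Rightarrow> 'b) \<Rightarrow> nat \<Rightarrow> ('a \<Rightarrow> 'b) \<Rightarrow> real" where
  "approximation_number sX sY n S =
     Inf {onorm (\<lambda>x. S x - L x) | L. bounded_operator sX sY L \<and> operator_rank sY L < enat n}"

definition gelfand_number ::
    "('k::real_or_complex_field \<Rightarrow> 'a::real_normed_vector \<Rightarrow> 'a) \<Rightarrow>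
     nat \<Rightarrow> ('a \<Rightarrow> 'b::real_normed_vector) \<Rightarrow> real" where
  "gelfand_number sX n S =
     Inf {onorm_on M S | M. closed M \<and> module.subspace sX M \<and> codim sX M < enat n}"

definition hilbert_ratios ::
    "('k::real_or_complex_field \<Rightarrow> 'a::real_normed_vector \<Rightarrow> 'a) \<Rightarrow>
     ('k \<Rightarrow> 'b::real_normed_vector \<Rightarrow> 'b) \<Rightarrow> nat \<Rightarrow> ('a \<Rightarrow> 'b) \<Rightarrow> real set" where
  "hilbert_ratios sX sY n S =
     {approximation_number scale_ell2 scale_ell2 n (B \<circ> S \<circ> A) / (onorm B * onorm A) | A B.
        bounded_operator scale_ell2 sX A \<and> bounded_operator sY scale_ell2 B \<and>
        A \<noteq> (\<lambda>_. 0) \<and> B \<noteq> (\<lambda>_. 0)}"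

text \<open>On \<^typ>\<open>real\<close>, \<^term>\<open>Sup {}\<close> is unspecified; here the supremum over the empty set is \<open>0\<close>.\<close>

definition hilbert_number ::
    "('k::real_or_complex_field \<Rightarrow> 'a::real_normed_vector \<Rightarrow> 'a) \<Rightarrow>
     ('k \<Rightarrow> 'b::real_normed_vector \<Rightarrow> 'b) \<Rightarrow> nat \<Rightarrow> ('a \<Rightarrow> 'b) \<Rightarrow> real" where
  "hilbert_number sX sY n S =
     (if hilbert_ratios sX sY n S = {} then 0 else Sup (hilbert_ratios sX sY n S))"

end

theory Submission
  imports Defs "Jordan_Normal_Form.Determinant"
begin

text \<open>
  The estimate behind both claims is
    \<open>a\<^sub>n(S) \<le> n (h\<^sub>1(S) \<cdots> h\<^sub>n(S))\<^bsup>1/n\<^esup>\<close>.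
  With \<open>h\<^sub>k(S) \<le> M k\<^bsup>-\<alpha>\<^esup>\<close> and \<open>n! \<ge> (n/e)\<^sup>n\<close> it gives
  \<open>a\<^sub>n(S) \<le> e\<^sup>\<alpha> n\<^bsup>1-\<alpha>\<^esup> M\<close>. The first inequality follows because
  \<open>c\<^sub>n(S) \<le> a\<^sub>n(S)\<close> (restrict \<open>S\<close> to the kernel of an operator \<open>L\<close> of rank less than \<open>n\<close>),
  and the second because \<open>n\<^bsup>1-\<alpha>\<^esup> \<le> 2 n\<^bsup>3/2-\<alpha>\<^esup>\<close>.

  To prove the estimate, let \<open>0 < c < a\<^sub>n(S)\<close> and run Gaussian elimination with complete
  pivoting on \<open>S\<close> (lemma \<open>complete_pivoting\<close>). Start with \<open>R = S\<close>; as long as fewer than \<open>n\<close>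
  steps have been made, \<open>S - R\<close> has rank less than \<open>n\<close>, so \<open>\<parallel>R\<parallel> > c\<close>, and by the Hahn-Banach theorem
  there are a vector \<open>x\<^sub>k\<close> and a functional \<open>y\<^sub>k\<close> in the unit balls with pivot
  \<open>\<bar>y\<^sub>k(R x\<^sub>k)\<bar> \<ge> c\<close>. Subtract from \<open>R\<close> the rank-one operator that clears the row and the
  column of the pivot. The result is a factorization of the matrix \<open>G = (y\<^sub>i(S x\<^sub>j))\<close> into a lower
  triangular matrix with the pivots on its diagonal and a unit upper triangular one, so that
  \<open>\<bar>det G\<bar> \<ge> c\<^sup>n\<close>.

  On the other hand, \<open>G\<close> is the matrix of \<open>T = B S A\<close> on \<open>\<ell>\<^sub>2\<close>, where \<open>A\<close> sends the \<open>k\<close>th unit vector to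
  \<open>x\<^sub>k\<close> and \<open>B z = (y\<^sub>k(z))\<^sub>k\<close>. Both have norm at most \<open>\<surd>n\<close>, so \<open>a\<^sub>k(T) \<le> n h\<^sub>k(S)\<close>, and it
  remains to see that \<open>\<bar>det G\<bar> \<le> a\<^sub>1(T) \<cdots> a\<^sub>n(T)\<close> (lemma
  \<open>norm_det_le_prod_approximation_numbers\<close>). Let \<open>L\<^sub>k\<close> be of rank less than \<open>k\<close> and almost optimal for
  \<open>a\<^sub>k(T)\<close>. Counting dimensions from \<open>k = n\<close> downwards yields an orthonormal basis with
  \<open>L\<^sub>k u\<^sub>k = 0\<close>, hence \<open>\<parallel>G u\<^sub>k\<parallel>\<close> is at most about \<open>a\<^sub>k(T)\<close>, and likewise an orthonormal basis \<open>v\<close>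
  with \<open>v\<^sub>k\<close> orthogonal to \<open>G u\<^sub>j\<close> for \<open>j < k\<close>. The matrix of the numbers \<open>\<langle>G u\<^sub>l, v\<^sub>k\<rangle>\<close> is
  triangular, its determinant has the same absolute value as that of \<open>G\<close>, and its diagonal entries are
  bounded by \<open>\<parallel>G u\<^sub>k\<parallel>\<close>.
\<close>

section \<open>Norming functionals over the reals\<close>

text \<open>
  Sublinear functionals. Requiring only \<open>\<le>\<close> in the homogeneity condition is no loss, see
  \<open>sublinear_scaleR\<close> below.
\<close>

definition sublinear :: "('a::real_vector \<Rightarrow> real) \<Rightarrow> bool" where
  "sublinear p \<longleftrightarrow> (\<forall>x y. p (x + y) \<le> p x + p y) \<and> (\<forall>t\<ge>0. \<forall>x. p (t *\<^sub>R x) \<le> t * p x)"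

lemma sublinear_add: "sublinear p \<Longrightarrow> p (x + y) \<le> p x + p y"
  by (simp add: sublinear_def)

lemma sublinear_zero:
  assumes "sublinear p"
  shows "p 0 = 0"
proof -
  have "p (0 *\<^sub>R 0) \<le> 0 * p 0"
    using assms unfolding sublinear_def by blast
  moreover have "p (0 + 0) \<le> p 0 + p 0"
    using assms by (rule sublinear_add)
  ultimately show ?thesis
    by simp
qed

lemma sublinear_scaleR:
  assumes "sublinear p" and "t \<ge> 0"
  shows "p (t *\<^sub>R x) = t * p x"
proof (cases "t = 0")
  case True
  then show ?thesis
    by (simp add: sublinear_zero assms(1))
next
  case False
  then have t: "t > 0"
    using assms(2) by simp
  have "p (inverse t *\<^sub>R (t *\<^sub>R x)) \<le> inverse t * p (t *\<^sub>R x)"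
    using assms t unfolding sublinear_def by (metis inverse_nonnegative_iff_nonnegative)
  then have "t * p x \<le> p (t *\<^sub>R x)"
    using t by (simp add: field_simps)
  moreover have "p (t *\<^sub>R x) \<le> t * p x"
    using assms unfolding sublinear_def by blast
  ultimately show ?thesis
    by simp
qed

lemma sublinear_neg:
  assumes "sublinear p"
  shows "- p (- x) \<le> p x"
  using sublinear_add[OF assms, of x "- x"] sublinear_zero[OF assms] by simp

lemma sublinear_norm: "sublinear norm"
  by (simp add: sublinear_def norm_triangle_ineq)

text \<open>
  The functional \<open>x \<mapsto> inf {p (x + t z) - t p z | t \<ge> 0}\<close>. It has two uses: it shows that a minimal
  sublinear functional is additive, and applied to the norm it forces a given value at \<open>z\<close>.
\<close>

lemma sublinear_pull_down:
  fixes p :: "'a::real_vector \<Rightarrow> real"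
  assumes p: "sublinear p"
  obtains q where "sublinear q" "\<And>x. q x \<le> p x" "\<And>x. q x \<le> p (x + z) - p z"
proof
  define q where "q = (\<lambda>x. INF t\<in>{0..}. p (x + t *\<^sub>R z) - t * p z)"
  have bdd: "bdd_below ((\<lambda>t. p (x + t *\<^sub>R z) - t * p z) ` {0..})" for x
  proof (rule bdd_belowI2)
    fix t :: real assume "t \<in> {0..}"
    then have "t * p z = p (t *\<^sub>R z)"
      by (simp add: sublinear_scaleR p)
    also have "\<dots> = p ((x + t *\<^sub>R z) + (- x))"
      by simp
    also have "\<dots> \<le> p (x + t *\<^sub>R z) + p (- x)"
      by (rule sublinear_add[OF p])
    finally show "- p (- x) \<le> p (x + t *\<^sub>R z) - t * p z"
      by simp
  qed
  have le: "q x \<le> p (x + t *\<^sub>R z) - t * p z" if "t \<ge> 0" for x t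
    unfolding q_def using that by (intro cINF_lower bdd) auto
  have ge: "c \<le> q x" if "\<And>t. t \<ge> 0 \<Longrightarrow> c \<le> p (x + t *\<^sub>R z) - t * p z" for c x
    unfolding q_def using that by (intro cINF_greatest) auto
  show qp: "q x \<le> p x" for x
    using le[of 0 x] by simp
  show "q x \<le> p (x + z) - p z" for x
    using le[of 1 x] by simp
  show "sublinear q"
    unfolding sublinear_def
  proof (intro conjI allI impI)
    fix x y
    have *: "q (x + y) \<le> (p (x + s *\<^sub>R z) - s * p z) + (p (y + t *\<^sub>R z) - t * p z)"
      if "s \<ge> 0" "t \<ge> 0" for s t
    proof -
      have "q (x + y) \<le> p (x + y + (s + t) *\<^sub>R z) - (s + t) * p z"
        using that by (intro le) auto
      also have "x + y + (s + t) *\<^sub>R z = (x + s *\<^sub>R z) + (y + t *\<^sub>R z)"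
        by (simp add: algebra_simps)
      finally show ?thesis
        using sublinear_add[OF p, of "x + s *\<^sub>R z" "y + t *\<^sub>R z"] by (simp add: algebra_simps)
    qed
    have "q (x + y) - (p (x + s *\<^sub>R z) - s * p z) \<le> q y" if "s \<ge> 0" for s
      using *[OF that] by (intro ge) (simp add: algebra_simps)
    then have "q (x + y) - q y \<le> q x"
      by (intro ge) (simp add: algebra_simps)
    then show "q (x + y) \<le> q x + q y"
      by simp
  next
    fix s :: real and x assume s: "s \<ge> 0"
    show "q (s *\<^sub>R x) \<le> s * q x"
    proof (cases "s = 0")
      case True
      then show ?thesis
        using qp[of 0] sublinear_zero[OF p] by simp
    next
      case False
      have "q (s *\<^sub>R x) / s \<le> q x"
      proof (rule ge)
        fix t :: real assume t: "t \<ge> 0"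
        have "q (s *\<^sub>R x) \<le> p (s *\<^sub>R x + (s * t) *\<^sub>R z) - (s * t) * p z"
          using s t by (intro le) auto
        also have "s *\<^sub>R x + (s * t) *\<^sub>R z = s *\<^sub>R (x + t *\<^sub>R z)"
          by (simp add: algebra_simps)
        finally show "q (s *\<^sub>R x) / s \<le> p (x + t *\<^sub>R z) - t * p z"
          using s False sublinear_scaleR[OF p s, of "x + t *\<^sub>R z"] by (simp add: field_simps)
      qed
      then show ?thesis
        using s False by (simp add: field_simps)
    qed
  qed
qed

text \<open>
  By Zorn's lemma: the pointwise infimum of a chain of sublinear functionals is sublinear.
\<close>

lemma sublinear_minimal_below:
  fixes p :: "'a::real_vector \<Rightarrow> real"
  assumes p: "sublinear p"
  obtains m where "sublinear m" "\<And>x. m x \<le> p x"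
    "\<And>q. sublinear q \<Longrightarrow> (\<And>x. q x \<le> m x) \<Longrightarrow> q = m"
proof -
  define A where "A = {q. sublinear q \<and> q \<le> p}"
  have "\<exists>m\<in>A. \<forall>a\<in>A. a \<le> m \<longrightarrow> a = m"
  proof (rule predicate_Zorn)
    show "partial_order_on A (relation_of (\<lambda>x y. y \<le> x) A)"
      by (rule partial_order_on_relation_ofI) auto
    fix C assume "C \<in> Chains (relation_of (\<lambda>x y. y \<le> x) A)"
    then have CA: "C \<subseteq> A" and ch: "\<And>a b. a \<in> C \<Longrightarrow> b \<in> C \<Longrightarrow> a \<le> b \<or> b \<le> a"
      by (auto simp: Chains_def relation_of_def)
    show "\<exists>u\<in>A. \<forall>a\<in>C. u \<le> a"
    proof (cases "C = {}")
      case True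
      then show ?thesis
        using p by (auto simp: A_def)
    next
      case False
      define u where "u = (\<lambda>x. INF q\<in>C. q x)"
      have sub: "sublinear q" and qp: "q x \<le> p x" if "q \<in> C" for q x
        using that CA by (auto simp: A_def le_fun_def)
      have bdd: "bdd_below ((\<lambda>q. q x) ` C)" for x
      proof (rule bdd_belowI2)
        fix q assume "q \<in> C"
        then show "- p (- x) \<le> q x"
          using sublinear_neg[OF sub, of q x] qp[of q "- x"] by simp
      qed
      have le: "u x \<le> q x" if "q \<in> C" for q x
        unfolding u_def using that by (intro cINF_lower bdd)
      have ge: "c \<le> u x" if "\<And>q. q \<in> C \<Longrightarrow> c \<le> q x" for c x
        unfolding u_def using that False by (intro cINF_greatest)
      have "sublinear u"
        unfolding sublinear_def
      proof (intro conjI allI impI)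
        fix x y
        have *: "u (x + y) \<le> q x + r y" if q: "q \<in> C" and r: "r \<in> C" for q r
        proof -
          from ch[OF q r] obtain s where "s \<in> C" "s \<le> q" "s \<le> r"
            using q r by auto
          then have "u (x + y) \<le> s x + s y" "s x \<le> q x" "s y \<le> r y"
            using le[of s "x + y"] sublinear_add[OF sub, of s x y] by (auto simp: le_fun_def)
          then show ?thesis
            by simp
        qed
        have "u (x + y) - q x \<le> u y" if "q \<in> C" for q
          using *[OF that] by (intro ge) (simp add: algebra_simps)
        then have "u (x + y) - u y \<le> u x"
          by (intro ge) (simp add: algebra_simps)
        then show "u (x + y) \<le> u x + u y"
          by simp
      next
        fix t :: real and x assume t: "t \<ge> 0"
        have *: "u (t *\<^sub>R x) \<le> t * q x" if "q \<in> C" for q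
          using le[OF that, of "t *\<^sub>R x"] by (simp add: sublinear_scaleR sub that t)
        show "u (t *\<^sub>R x) \<le> t * u x"
        proof (cases "t = 0")
          case True
          then show ?thesis
            using * False by auto
        next
          case False
          then have "u (t *\<^sub>R x) / t \<le> u x"
            using * t by (intro ge) (simp add: field_simps)
          then show ?thesis
            using False t by (simp add: field_simps)
        qed
      qed
      moreover have "u \<le> p"
        using False le qp unfolding le_fun_def by (meson all_not_in_conv order_trans)
      ultimately show ?thesis
        using le by (auto simp: A_def le_fun_def)
    qed
  qed
  then obtain m where m: "m \<in> A" and min: "\<And>q. q \<in> A \<Longrightarrow> q \<le> m \<Longrightarrow> q = m"
    by blast
  show ?thesis
  proof
    show "sublinear m" "m x \<le> p x" for x
      using m by (auto simp: A_def le_fun_def)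
    show "q = m" if "sublinear q" "\<And>x. q x \<le> m x" for q
    proof (rule min)
      show "q \<le> m"
        using that(2) by (simp add: le_fun_def)
      then show "q \<in> A"
        using that(1) m by (auto simp: A_def)
    qed
  qed
qed

text \<open>
  The Hahn-Banach theorem in the form needed here. A sublinear functional that is minimal among all of
  them is linear; start below the norm with one whose value at \<open>-v\<close> is at most \<open>-\<parallel>v\<parallel>\<close>.
\<close>

lemma real_norming_functional:
  fixes v :: "'a::real_normed_vector"
  obtains f where "linear f" "\<And>x. f x \<le> norm x" "f v = norm v"
proof -
  obtain p where p: "sublinear p" "\<And>x. p x \<le> norm x" "\<And>x. p x \<le> norm (x + v) - norm v"
    using sublinear_pull_down[OF sublinear_norm, of v] by blast
  obtain m where m: "sublinear m" "\<And>x. m x \<le> p x"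
    and min: "\<And>q. sublinear q \<Longrightarrow> (\<And>x. q x \<le> m x) \<Longrightarrow> q = m"
    using sublinear_minimal_below[OF p(1)] by blast
  have add: "m (x + y) = m x + m y" for x y
  proof -
    obtain q where q: "sublinear q" "\<And>x. q x \<le> m x" "\<And>x. q x \<le> m (x + y) - m y"
      using sublinear_pull_down[OF m(1), of y] by blast
    then have "q = m"
      by (intro min)
    with q(3)[of x] sublinear_add[OF m(1), of x y] show ?thesis
      by simp
  qed
  have neg: "m (- x) = - m x" for x
    using add[of x "- x"] sublinear_zero[OF m(1)] by simp
  have "linear m"
  proof (rule linearI)
    show "m (x + y) = m x + m y" for x y
      by (rule add)
    show "m (r *\<^sub>R x) = r *\<^sub>R m x" for r x
    proof (cases "r \<ge> 0")
      case True
      then show ?thesis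
        by (simp add: sublinear_scaleR m(1))
    next
      case False
      then have "m ((- r) *\<^sub>R x) = - r * m x"
        by (intro sublinear_scaleR m(1)) simp
      then show ?thesis
        using neg[of "r *\<^sub>R x"] by simp
    qed
  qed
  moreover have le: "m x \<le> norm x" for x
    using m(2) p(2) by (rule order_trans)
  moreover have "m v = norm v"
    using m(2)[of "- v"] p(3)[of "- v"] neg[of v] le[of v] by simp
  ultimately show ?thesis
    using that by blast
qed

section \<open>Conjugation of scalars and norming functionals\<close>

text \<open>
  In the complex case the isomorphism automatically fixes the reals: an additive map that preserves
  the norm is real-linear.
\<close>

lemma scalar_cases:
  obtains (real) "\<And>x :: 'k::real_or_complex_field. \<exists>r. x = of_real r"
  | (complex) \<phi> :: "complex \<Rightarrow> 'k::real_or_complex_field"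
    where "bij \<phi>" "\<And>z w. \<phi> (z + w) = \<phi> z + \<phi> w" "\<And>z w. \<phi> (z * w) = \<phi> z * \<phi> w"
      "\<And>z. norm (\<phi> z) = norm z" "\<And>r. \<phi> (of_real r) = of_real r"
proof -
  consider "\<forall>x :: 'k. \<exists>r. x = r *\<^sub>R 1"
    | \<phi> :: "complex \<Rightarrow> 'k" where "bij \<phi>" "\<phi> 1 = 1" "\<forall>z w. \<phi> (z + w) = \<phi> z + \<phi> w"
      "\<forall>z w. \<phi> (z * w) = \<phi> z * \<phi> w" "\<forall>z. norm (\<phi> z) = norm z"
    using real_or_complex[where 'a = 'k] by blast
  then show thesis
  proof cases
    case 1
    then show ?thesis
      using real by (auto simp: of_real_def)
  next
    case (2 \<phi>)
    have add: "\<phi> (z + w) = \<phi> z + \<phi> w" for z w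
      using 2 by blast
    have zero: "\<phi> 0 = 0"
      using add[of 0 0] by simp
    have minus: "\<phi> (- z) = - \<phi> z" for z
      using add[of z "- z"] zero by (simp add: eq_neg_iff_add_eq_0 add.commute)
    have diff: "\<phi> (z - w) = \<phi> z - \<phi> w" for z w
      using add[of z "- w"] minus by simp
    have nat_mult: "\<phi> (of_nat N * z) = of_nat N * \<phi> z" for N z
      by (induction N) (auto simp: zero add ring_distribs)
    have nat: "\<phi> (of_nat N) = of_nat N" for N
      using nat_mult[of N 1] 2 by simp
    have int: "\<phi> (of_int m) = of_int m" for m
      by (cases m rule: int_cases2) (simp_all add: nat minus)
    have "\<phi> (of_real r) = of_real r" for r
    proof -
      define d where "d = norm (\<phi> (of_real r) - of_real r)"
      have "of_nat N * d \<le> 2" for N :: nat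
      proof -
        \<comment> \<open>both \<open>\<phi> r\<close> and \<open>r\<close> are within \<open>1 / N\<close> of \<open>m / N\<close>\<close>
        define m where "m = \<lfloor>real N * r\<rfloor>"
        have m: "\<bar>real N * r - of_int m\<bar> \<le> 1"
          unfolding m_def by linarith
        have "of_nat N * of_real r - of_int m = complex_of_real (real N * r - of_int m)"
          by simp
        then have "norm (\<phi> (of_nat N * of_real r) - of_int m) = norm (\<phi> (of_real (real N * r - of_int m)))"
          by (metis diff int)
        also have "\<dots> \<le> 1"
          using 2 m by (metis norm_of_real)
        finally have 1: "norm (of_nat N * \<phi> (of_real r) - of_int m) \<le> 1"
          by (simp add: nat_mult)
        have "norm (of_nat N * of_real r - of_int m :: 'k) = norm (of_real (real N * r - of_int m) :: 'k)"
          by simp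
        also have "\<dots> \<le> 1"
          using m by (simp only: norm_of_real)
        finally have 2: "norm (of_nat N * of_real r - of_int m :: 'k) \<le> 1" .
        have "of_nat N * d = norm (of_nat N * (\<phi> (of_real r) - of_real r))"
          by (simp add: d_def norm_mult)
        also have "\<dots> = norm ((of_nat N * \<phi> (of_real r) - of_int m) - (of_nat N * of_real r - of_int m))"
          by (simp add: algebra_simps)
        also have "\<dots> \<le> 2"
          using 1 2 norm_triangle_ineq4[of "of_nat N * \<phi> (of_real r) - of_int m"
            "of_nat N * of_real r - of_int m"] by linarith
        finally show ?thesis .
      qed
      moreover have "\<exists>N. 2 < of_nat N * d" if "d > 0"
        using that by (rule reals_Archimedean3[rule_format])
      ultimately have "\<not> d > 0"
        using not_less by blast
      then show ?thesis
        by (simp add: d_def)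
    qed
    with complex 2 show ?thesis
      by blast
  qed
qed

text \<open>
  Conjugation: the number \<open>y\<close> with \<open>x y = \<bar>x\<bar>\<^sup>2\<close>, so that no reference to the choice of an isomorphism
  with the complex numbers is needed; only additivity depends on the classification of the scalars. At
  \<open>0\<close> the value is \<open>0 / 0 = 0\<close>.
\<close>

definition scalar_conj :: "'k::real_or_complex_field \<Rightarrow> 'k" where
  "scalar_conj x = of_real ((norm x)\<^sup>2) / x"

lemma scalar_conj_zero [simp]: "scalar_conj 0 = 0"
  by (simp add: scalar_conj_def)

lemma scalar_conj_one [simp]: "scalar_conj 1 = 1"
  by (simp add: scalar_conj_def)

lemma mult_scalar_conj: "x * scalar_conj x = of_real ((norm x)\<^sup>2)"
  by (simp add: scalar_conj_def)

lemma scalar_conj_mult: "scalar_conj (x * y) = scalar_conj x * scalar_conj y"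
  by (simp add: scalar_conj_def norm_mult power_mult_distrib)

lemma norm_scalar_conj [simp]: "norm (scalar_conj x) = norm x"
  by (simp add: scalar_conj_def norm_divide norm_power power2_eq_square norm_mult)

lemma scalar_conj_conj [simp]: "scalar_conj (scalar_conj x) = x"
  by (cases "x = 0") (simp_all add: scalar_conj_def[of "scalar_conj x"], simp add: scalar_conj_def)

lemma scalar_conj_add: "scalar_conj (x + y) = scalar_conj x + scalar_conj (y :: 'k::real_or_complex_field)"
proof (cases rule: scalar_cases[where 'k = 'k])
  case real
  have "scalar_conj z = z" for z :: 'k
  proof -
    obtain r where "z = of_real r"
      using real by blast
    then show ?thesis
      by (simp add: scalar_conj_def power2_eq_square flip: of_real_mult of_real_divide)
  qed
  then show ?thesis
    by simp
next
  case (complex \<phi>)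
  have conj: "scalar_conj (\<phi> z) = \<phi> (cnj z)" for z
  proof (cases "z = 0")
    case True
    then show ?thesis
      using complex(5)[of 0] by simp
  next
    case False
    then have "\<phi> z \<noteq> 0"
      using complex(4)[of z] by auto
    moreover have "\<phi> z * \<phi> (cnj z) = of_real ((norm (\<phi> z))\<^sup>2)"
      using complex(3)[of z "cnj z"] complex(4)[of z] complex(5) complex_norm_square[of z] by metis
    ultimately show ?thesis
      by (simp add: scalar_conj_def field_simps)
  qed
  obtain z w where "x = \<phi> z" "y = \<phi> w"
    using complex(1) by (metis bij_pointE)
  then show ?thesis
    by (simp add: conj flip: complex(2))
qed

lemma scalar_conj_sum: "scalar_conj (\<Sum>i\<in>A. f i) = (\<Sum>i\<in>A. scalar_conj (f i))"
  by (induction A rule: infinite_finite_induct) (auto simp: scalar_conj_add)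

lemma normed_space_over_self: "normed_space_over ((*) :: 'k::real_or_complex_field \<Rightarrow> 'k \<Rightarrow> 'k)"
  by unfold_locales (auto simp: algebra_simps norm_mult scaleR_conv_of_real)

lemma bounded_operatorI:
  assumes "normed_space_over sX" and "normed_space_over sY"
    and add: "\<And>x y. T (x + y) = T x + T y" and scale: "\<And>c x. T (sX c x) = sY c (T x)"
    and bound: "\<And>x. norm (T x) \<le> K * norm x"
  shows "bounded_operator sX sY T"
proof -
  interpret X: normed_space_over sX by fact
  interpret Y: normed_space_over sY by fact
  have "Vector_Spaces.linear sX sY T"
    using add scale by unfold_locales auto
  moreover have "bounded_linear T"
  proof (rule bounded_linear_intro)
    show "T (r *\<^sub>R x) = r *\<^sub>R T x" for r x
      by (metis scale X.scale_of_real Y.scale_of_real)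
    show "norm (T x) \<le> norm x * K" for x
      using bound[of x] by (simp add: mult.commute)
  qed (rule add)
  ultimately show ?thesis
    by (simp add: bounded_operator_def)
qed

text \<open>
  In the complex case the functional is \<open>x \<mapsto> g x - \<i> g (\<i> x)\<close> for a real norming functional \<open>g\<close>.
\<close>

lemma norming_functional:
  fixes s :: "'k::real_or_complex_field \<Rightarrow> 'a::real_normed_vector \<Rightarrow> 'a"
  assumes "normed_space_over s"
  obtains f :: "'a \<Rightarrow> 'k" where "bounded_operator s (*) f" "\<And>x. norm (f x) \<le> norm x" "norm (f v) = norm v"
proof -
  interpret normed_space_over s by fact
  obtain g where g: "linear g" "\<And>x. g x \<le> norm x" "g v = norm v"
    using real_norming_functional[of v] by blast
  have g_add: "g (x + y) = g x + g y" and g_scale: "g (r *\<^sub>R x) = r * g x" for x y r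
    using linear_add[OF g(1)] linear_scale[OF g(1)] by auto
  have g_abs: "\<bar>g x\<bar> \<le> norm x" for x
    using g(2)[of x] g(2)[of "- x"] g_scale[of "-1" x] by simp
  note functionalI = that
  have result: thesis if f_lin: "\<And>x y. f (x + y) = f x + f y" "\<And>c x. f (s c x) = c * f x"
    and f_norm: "\<And>x. norm (f x) \<le> norm x" and f_v: "norm (f v) = norm v" for f :: "'a \<Rightarrow> 'k"
  proof (rule functionalI)
    show "bounded_operator s (*) f"
      using f_lin f_norm by (intro bounded_operatorI[where K = 1] assms normed_space_over_self) simp_all
  qed (rule f_norm f_v)+
  show thesis
  proof (cases rule: scalar_cases[where 'k = 'k])
    case real
    show ?thesis
    proof (rule result)
      show "of_real (g (x + y)) = of_real (g x) + (of_real (g y) :: 'k)" for x y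
        by (simp add: g_add)
      show "of_real (g (s c x)) = c * of_real (g x)" for c x
      proof -
        obtain r where "c = of_real r"
          using real by blast
        then show ?thesis
          by (simp add: scale_of_real g_scale)
      qed
      show "norm (of_real (g x) :: 'k) \<le> norm x" for x
        by (simp add: g_abs)
      show "norm (of_real (g v) :: 'k) = norm v"
        by (simp add: g(3))
    qed
  next
    case (complex \<phi>)
    define J where "J = \<phi> \<i>"
    define f where "f x = \<phi> (Complex (g x) (- g (s J x)))" for x
    have f_add: "f (x + y) = f x + f y" for x y
      by (simp add: f_def g_add scale_right_distrib complex_add flip: complex(2))
    have J: "s J (s J x) = - x" for x
    proof -
      have "J * J = of_real (- 1)"
        unfolding J_def by (metis complex(3) complex(5) i_squared of_real_1 of_real_minus)
      then show ?thesis
        by (simp only: scale_scale scale_of_real) simp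
    qed
    have f_real: "f (r *\<^sub>R x) = of_real r * f x" for r x
    proof -
      have "s J (r *\<^sub>R x) = r *\<^sub>R s J x"
        by (metis scale_left_commute scale_of_real)
      then have "Complex (g (r *\<^sub>R x)) (- g (s J (r *\<^sub>R x))) = of_real r * Complex (g x) (- g (s J x))"
        by (simp add: g_scale complex_eq_iff)
      then show ?thesis
        by (simp add: f_def complex(3) complex(5))
    qed
    have f_J: "f (s J x) = J * f x" for x
    proof -
      have "Complex (g (s J x)) (- g (s J (s J x))) = \<i> * Complex (g x) (- g (s J x))"
        using g_scale[of "-1" x] by (simp add: J complex_eq_iff del: scale_scale)
      then show ?thesis
        by (simp add: f_def J_def complex(3))
    qed
    have f_scale: "f (s c x) = c * f x" for c x
    proof -
      obtain z where z: "c = \<phi> z"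
        using complex(1) by (metis bij_pointE)
      have "c = of_real (Re z) + of_real (Im z) * J"
        unfolding z J_def by (metis complex_eq complex(2,3,5) mult.commute)
      then show ?thesis
        by (simp add: scale_left_distrib f_add f_real f_J ring_distribs scale_of_real flip: scale_scale)
    qed
    have f_norm: "norm (f x) \<le> norm x" for x
    proof (cases "f x = 0")
      case False
      \<comment> \<open>rotate \<open>x\<close> so that the value of \<open>f\<close> becomes real and hence equal to that of \<open>g\<close>\<close>
      define c where "c = of_real (norm (f x)) / f x"
      have c: "norm c = 1"
        using False by (simp add: c_def norm_divide)
      have "f (s c x) = of_real (norm (f x))"
        using False by (simp add: f_scale c_def)
      then have "\<phi> (Complex (g (s c x)) (- g (s J (s c x)))) = \<phi> (of_real (norm (f x)))"
        by (simp add: f_def complex(5))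
      then have "norm (f x) = g (s c x)"
        using complex(1) by (auto simp: bij_def inj_eq complex_eq_iff)
      also have "\<dots> \<le> norm x"
        using g(2)[of "s c x"] by (simp add: norm_scale c)
      finally show ?thesis .
    qed simp
    have "norm v \<le> norm (f v)"
    proof -
      have "\<bar>Re (Complex (g v) (- g (s J v)))\<bar> \<le> norm (Complex (g v) (- g (s J v)))"
        by (rule abs_Re_le_cmod)
      then show ?thesis
        by (simp add: f_def complex(4) g(3))
    qed
    then show ?thesis
      using result[of f] f_add f_scale f_norm by (simp add: order_antisym)
  qed
qed

section \<open>Orthonormal systems and determinants\<close>

lemma comm_ring_hom_scalar_conj: "comm_ring_hom (scalar_conj :: 'k::real_or_complex_field \<Rightarrow> 'k)"
  by unfold_locales (auto simp: scalar_conj_add scalar_conj_mult)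

text \<open>
  Linear equations \<open>a\<^sub>0 u\<^sub>0 + \<dots> + a\<^sub>n\<^sub>-\<^sub>1 u\<^sub>n\<^sub>-\<^sub>1 = 0\<close> are represented by their coefficient
  functions \<open>a\<close>, and vectors of length \<open>n\<close> by functions that matter only below \<open>n\<close>.
\<close>

lemma homogeneous_system_solvable:
  fixes F :: "(nat \<Rightarrow> 'k::field) set"
  assumes "finite F" and "card F < n"
  obtains u where "\<And>a. a \<in> F \<Longrightarrow> (\<Sum>j<n. a j * u j) = 0" "\<exists>j<n. u j \<noteq> 0"
proof -
  obtain as where as: "set as = F" "length as = card F"
    using finite_distinct_list[OF assms(1)] distinct_card by metis
  \<comment> \<open>padded by at least one zero row\<close>
  define A where "A = mat n n (\<lambda>(i, j). if i < length as then (as ! i) j else 0)"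
  have A: "A \<in> carrier_mat n n"
    by (simp add: A_def)
  have "row A (n - 1) = 0\<^sub>v n"
    using assms as by (auto simp: A_def)
  then have "A $$ (n - 1, j) = 0" if "j < n" for j
    using assms as that by (simp add: A_def)
  then have "det A = 0"
    using laplace_expansion_row[OF A, of "n - 1"] assms by simp
  then obtain v where v: "v \<in> carrier_vec n" "v \<noteq> 0\<^sub>v n" "A *\<^sub>v v = 0\<^sub>v n"
    using det_0_iff_vec_prod_zero_field[OF A] by blast
  show ?thesis
  proof
    fix a assume "a \<in> F"
    then obtain i where i: "i < length as" "as ! i = a"
      using as by (metis in_set_conv_nth)
    have "(A *\<^sub>v v) $ i = 0"
      using v i as assms by simp
    moreover have "(A *\<^sub>v v) $ i = (\<Sum>j<n. a j * v $ j)"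
      using i v(1) as(2) assms(2) by (simp add: A_def scalar_prod_def atLeast0LessThan)
    ultimately show "(\<Sum>j<n. a j * v $ j) = 0"
      by simp
  next
    show "\<exists>j<n. v $ j \<noteq> 0"
      using v by (metis carrier_vecD eq_vecI index_zero_vec)
  qed
qed

text \<open>
  Choose \<open>u\<^sub>k\<close> from \<open>k = n - 1\<close> downwards: the at most \<open>k\<close> equations in \<open>F k\<close> and the \<open>n - 1 - k\<close>
  orthogonality conditions are together fewer than \<open>n\<close>.
\<close>

lemma orthonormal_system_solving:
  fixes F :: "nat \<Rightarrow> (nat \<Rightarrow> 'k::real_or_complex_field) set"
  assumes F: "\<And>k. k < n \<Longrightarrow> finite (F k) \<and> card (F k) \<le> k"
  obtains u where "\<And>k a. k < n \<Longrightarrow> a \<in> F k \<Longrightarrow> (\<Sum>j<n. a j * u k j) = 0"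
    "\<And>k l. k < n \<Longrightarrow> l < n \<Longrightarrow> (\<Sum>j<n. u k j * scalar_conj (u l j)) = (if k = l then 1 else 0)"
proof -
  have "\<exists>u. (\<forall>k a. n - m \<le> k \<longrightarrow> k < n \<longrightarrow> a \<in> F k \<longrightarrow> (\<Sum>j<n. a j * u k j) = 0) \<and>
     (\<forall>k l. n - m \<le> k \<longrightarrow> k < n \<longrightarrow> n - m \<le> l \<longrightarrow> l < n \<longrightarrow>
        (\<Sum>j<n. u k j * scalar_conj (u l j)) = (if k = l then 1 else 0))" if "m \<le> n" for m
    using that
  proof (induction m)
    case 0
    then show ?case
      by auto
  next
    case (Suc m)
    then have "m \<le> n"
      by simp
    with Suc.IH obtain u where u1: "\<And>k a. n - m \<le> k \<Longrightarrow> k < n \<Longrightarrow> a \<in> F k \<Longrightarrow> (\<Sum>j<n. a j * u k j) = 0"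
      and u2: "\<And>k l. n - m \<le> k \<Longrightarrow> k < n \<Longrightarrow> n - m \<le> l \<Longrightarrow> l < n \<Longrightarrow>
        (\<Sum>j<n. u k j * scalar_conj (u l j)) = (if k = l then 1 else 0)"
      by blast
    \<comment> \<open>the index of the vector chosen in this step\<close>
    define q where "q = n - Suc m"
    have q: "q < n" "n - m = Suc q"
      using Suc.prems by (auto simp: q_def)
    define G where "G = F q \<union> (\<lambda>l j. scalar_conj (u l j)) ` {Suc q..<n}"
    have "card G \<le> card (F q) + card {Suc q..<n}"
      unfolding G_def by (rule order_trans[OF card_Un_le add_left_mono[OF card_image_le]]) simp
    also have "\<dots> < n"
      using F[OF q(1)] q(1) unfolding card_atLeastLessThan by linarith
    finally have "card G < n" .
    moreover have "finite G"
      using F[OF q(1)] by (simp add: G_def)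
    ultimately obtain w where w: "\<And>a. a \<in> G \<Longrightarrow> (\<Sum>j<n. a j * w j) = 0" "\<exists>j<n. w j \<noteq> 0"
      using homogeneous_system_solvable[of G n] by blast
    define r where "r = sqrt (\<Sum>j<n. (norm (w j))\<^sup>2)"
    have "(\<Sum>j<n. (norm (w j))\<^sup>2) > 0"
      using w(2) by (auto intro!: sum_pos2)
    then have r: "r \<noteq> 0" "r\<^sup>2 = (\<Sum>j<n. (norm (w j))\<^sup>2)"
      by (auto simp: r_def)
    define z where "z j = w j / of_real r" for j
    have z1: "(\<Sum>j<n. a j * z j) = 0" if "a \<in> G" for a
      using w(1)[OF that] by (simp add: z_def flip: sum_divide_distrib)
    have "(\<Sum>j<n. z j * scalar_conj (z j)) = of_real (\<Sum>j<n. (norm (w j))\<^sup>2 / r\<^sup>2)"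
      by (simp add: mult_scalar_conj z_def norm_divide power_divide)
    also have "\<dots> = 1"
      using r(1) unfolding sum_divide_distrib[symmetric] r(2)[symmetric] by simp
    finally have z2: "(\<Sum>j<n. z j * scalar_conj (z j)) = 1" .
    have z3: "(\<Sum>j<n. z j * scalar_conj (u l j)) = 0" if "Suc q \<le> l" "l < n" for l
      using z1[of "\<lambda>j. scalar_conj (u l j)"] that by (auto simp: G_def mult.commute)
    have z4: "(\<Sum>j<n. u l j * scalar_conj (z j)) = 0" if "Suc q \<le> l" "l < n" for l
    proof -
      have "scalar_conj (\<Sum>j<n. z j * scalar_conj (u l j)) = 0"
        by (simp add: z3 that)
      then show ?thesis
        by (simp add: scalar_conj_sum scalar_conj_mult mult.commute)
    qed
    have less: "Suc q \<le> k" if "q \<le> k" "k \<noteq> q" for k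
      using that by simp
    show ?case
    proof (intro exI[of _ "u(q := z)"] conjI allI impI)
      fix k a assume "n - Suc m \<le> k" "k < n" "a \<in> F k"
      then show "(\<Sum>j<n. a j * (u(q := z)) k j) = 0"
        using z1[of a] u1[of k a] less[of k] q by (cases "k = q") (auto simp: G_def q_def[symmetric])
    next
      fix k l assume "n - Suc m \<le> k" "k < n" "n - Suc m \<le> l" "l < n"
      then show "(\<Sum>j<n. (u(q := z)) k j * scalar_conj ((u(q := z)) l j)) = (if k = l then 1 else 0)"
        using less[of k] less[of l] q u2[of k l] z2 z3[of l] z4[of k]
        by (cases "k = q"; cases "l = q") (auto simp: q_def[symmetric])
    qed
  qed
  from this[of n] obtain u where
    "\<forall>k a. k < n \<longrightarrow> a \<in> F k \<longrightarrow> (\<Sum>j<n. a j * u k j) = 0"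
    "\<forall>k l. k < n \<longrightarrow> l < n \<longrightarrow> (\<Sum>j<n. u k j * scalar_conj (u l j)) = (if k = l then 1 else 0)"
    by auto
  then show ?thesis
    by (intro that[of u]) simp_all
qed

lemma norm_inner_le:
  fixes u v :: "nat \<Rightarrow> 'k::real_or_complex_field"
  assumes "(\<Sum>j<n. v j * scalar_conj (v j)) = 1"
  shows "norm (\<Sum>j<n. u j * scalar_conj (v j)) \<le> sqrt (\<Sum>j<n. (norm (u j))\<^sup>2)"
proof -
  have "of_real (\<Sum>j<n. (norm (v j))\<^sup>2) = (of_real 1 :: 'k)"
    using assms by (simp add: mult_scalar_conj)
  then have v: "(\<Sum>j<n. (norm (v j))\<^sup>2) = 1"
    by (simp only: of_real_eq_iff)
  have "norm (\<Sum>j<n. u j * scalar_conj (v j)) \<le> (\<Sum>j<n. \<bar>norm (u j)\<bar> * \<bar>norm (v j)\<bar>)"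
    by (rule order_trans[OF norm_sum]) (simp add: norm_mult)
  also have "\<dots> \<le> L2_set (\<lambda>j. norm (u j)) {..<n} * L2_set (\<lambda>j. norm (v j)) {..<n}"
    by (rule L2_set_mult_ineq)
  finally show ?thesis
    by (simp add: L2_set_def v)
qed

lemma norm_det_unitary:
  fixes u :: "nat \<Rightarrow> nat \<Rightarrow> 'k::real_or_complex_field"
  assumes "\<And>k l. k < n \<Longrightarrow> l < n \<Longrightarrow> (\<Sum>j<n. u k j * scalar_conj (u l j)) = (if k = l then 1 else 0)"
  shows "norm (det (mat n n (\<lambda>(k, j). u k j))) = 1"
    and "norm (det (mat n n (\<lambda>(k, j). scalar_conj (u k j)))) = 1"
proof -
  interpret comm_ring_hom "scalar_conj :: 'k \<Rightarrow> 'k"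
    by (rule comm_ring_hom_scalar_conj)
  let ?U = "mat n n (\<lambda>(k, j). u k j)" and ?V = "mat n n (\<lambda>(k, j). scalar_conj (u k j))"
  have V: "?V = map_mat scalar_conj ?U"
    by (rule eq_matI) auto
  have "?U * transpose_mat ?V = 1\<^sub>m n"
    by (rule eq_matI) (auto simp: scalar_prod_def atLeast0LessThan assms)
  then have "det ?U * det ?V = 1"
    by (metis det_mult det_one det_transpose mat_carrier transpose_carrier_mat)
  moreover have V': "norm (det ?V) = norm (det ?U)"
    unfolding V hom_det by simp
  ultimately have "(norm (det ?U))\<^sup>2 = 1"
    by (metis norm_mult norm_one power2_eq_square)
  then show "norm (det ?U) = 1"
    by (simp add: power2_eq_1_iff) (smt (verit) norm_ge_zero)
  with V' show "norm (det ?V) = 1"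
    by simp
qed

text \<open>
  A variant of Hadamard's inequality: \<open>b k\<close> bounds the matrix only on the unit vectors that solve the
  at most \<open>k\<close> equations in \<open>F k\<close>.
\<close>

lemma det_le_prod_of_kernels:
  fixes g :: "nat \<Rightarrow> nat \<Rightarrow> 'k::real_or_complex_field"
  assumes F: "\<And>k. k < n \<Longrightarrow> finite (F k) \<and> card (F k) \<le> k"
    and b: "\<And>k u. k < n \<Longrightarrow> (\<And>a. a \<in> F k \<Longrightarrow> (\<Sum>j<n. a j * u j) = 0) \<Longrightarrow>
      (\<Sum>j<n. (norm (u j))\<^sup>2) = 1 \<Longrightarrow> sqrt (\<Sum>i<n. (norm (\<Sum>j<n. g i j * u j))\<^sup>2) \<le> b k"
  shows "norm (det (mat n n (\<lambda>(i, j). g i j))) \<le> (\<Prod>k<n. b k)"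
proof -
  obtain u where u: "\<And>k a. k < n \<Longrightarrow> a \<in> F k \<Longrightarrow> (\<Sum>j<n. a j * u k j) = 0"
    and u_on: "\<And>k l. k < n \<Longrightarrow> l < n \<Longrightarrow>
      (\<Sum>j<n. u k j * scalar_conj (u l j)) = (if k = l then 1 else 0)"
    using orthonormal_system_solving[OF F] by blast
  define h where "h l i = (\<Sum>j<n. g i j * u l j)" for l i
  have h: "sqrt (\<Sum>i<n. (norm (h k i))\<^sup>2) \<le> b k" if "k < n" for k
    unfolding h_def
  proof (rule b[OF that])
    show "(\<Sum>j<n. a j * u k j) = 0" if "a \<in> F k" for a
      using u \<open>k < n\<close> that by blast
    have "of_real (\<Sum>j<n. (norm (u k j))\<^sup>2) = (of_real 1 :: 'k)"
      using u_on[OF that that] by (simp add: mult_scalar_conj)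
    then show "(\<Sum>j<n. (norm (u k j))\<^sup>2) = 1"
      by (simp only: of_real_eq_iff)
  qed
  have "finite ((\<lambda>l i. scalar_conj (h l i)) ` {..<k}) \<and> card ((\<lambda>l i. scalar_conj (h l i)) ` {..<k}) \<le> k"
    for k
    using card_image_le[of "{..<k}"] by simp
  then obtain v where v: "\<And>k a. k < n \<Longrightarrow> a \<in> (\<lambda>l i. scalar_conj (h l i)) ` {..<k} \<Longrightarrow> (\<Sum>i<n. a i * v k i) = 0"
    and v_on: "\<And>k l. k < n \<Longrightarrow> l < n \<Longrightarrow>
      (\<Sum>j<n. v k j * scalar_conj (v l j)) = (if k = l then 1 else 0)"
    using orthonormal_system_solving[of n "\<lambda>k. (\<lambda>l i. scalar_conj (h l i)) ` {..<k}"] by blast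
  let ?U = "mat n n (\<lambda>(k, j). u k j)" and ?V = "mat n n (\<lambda>(k, j). scalar_conj (v k j))"
  let ?G = "mat n n (\<lambda>(i, j). g i j)"
  define T where "T = mat n n (\<lambda>(k, l). \<Sum>i<n. h l i * scalar_conj (v k i))"
  have T_eq: "?V * (?G * transpose_mat ?U) = T"
    by (rule eq_matI) (auto simp: T_def scalar_prod_def atLeast0LessThan h_def mult.commute)
  have car: "?U \<in> carrier_mat n n" "?V \<in> carrier_mat n n" "?G \<in> carrier_mat n n"
    by simp_all
  have U': "transpose_mat ?U \<in> carrier_mat n n"
    by simp
  have "det T = det ?V * (det ?G * det (transpose_mat ?U))"
    unfolding T_eq[symmetric]
    using det_mult[OF car(2) mult_carrier_mat[OF car(3) U']] det_mult[OF car(3) U'] by simp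
  also have "det (transpose_mat ?U) = det ?U"
    by (rule det_transpose[OF car(1)])
  finally have "det T = det ?V * (det ?G * det ?U)" .
  then have "norm (det ?G) = norm (det T)"
    using norm_det_unitary(1)[of n u, OF u_on] norm_det_unitary(2)[of n v, OF v_on] by (simp add: norm_mult)
  also have "det T = prod_list (diag_mat T)"
  proof (rule det_upper_triangular)
    show "T \<in> carrier_mat n n"
      by (simp add: T_def)
    show "upper_triangular T"
    proof (rule upper_triangularI)
      fix k l assume "l < k" "k < dim_row T"
      then have kl: "l < k" "k < n"
        by (simp_all add: T_def)
      then have "(\<Sum>i<n. scalar_conj (h l i) * v k i) = 0"
        by (intro v) auto
      then have "scalar_conj (\<Sum>i<n. scalar_conj (h l i) * v k i) = 0"
        by simp
      then have "(\<Sum>i<n. h l i * scalar_conj (v k i)) = 0"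
        by (simp add: scalar_conj_sum scalar_conj_mult)
      then show "T $$ (k, l) = 0"
        using kl by (simp add: T_def)
    qed
  qed
  also have "\<dots> = (\<Prod>k<n. \<Sum>i<n. h k i * scalar_conj (v k i))"
    by (simp add: prod_list_diag_prod T_def atLeast0LessThan)
  also have "norm \<dots> = (\<Prod>k<n. norm (\<Sum>i<n. h k i * scalar_conj (v k i)))"
    by (rule prod_norm[symmetric])
  also have "\<dots> \<le> (\<Prod>k<n. b k)"
  proof (rule prod_mono, intro conjI)
    fix k assume "k \<in> {..<n}"
    then have k: "k < n"
      by simp
    have "(\<Sum>j<n. v k j * scalar_conj (v k j)) = 1"
      using v_on[OF k k] by simp
    from norm_inner_le[OF this, of "h k"] h[OF k]
    show "norm (\<Sum>i<n. h k i * scalar_conj (v k i)) \<le> b k"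
      by simp
  qed simp
  finally show ?thesis .
qed

section \<open>Bounded operators, approximation and Gelfand numbers\<close>

lemma
  assumes "bounded_operator sX sY T"
  shows bounded_operator_add: "T (x + y) = T x + T y"
    and bounded_operator_scale: "T (sX c x) = sY c (T x)"
    and bounded_operator_zero: "T 0 = 0"
    and bounded_operator_diff: "T (x - y) = T x - T y"
    and bounded_operator_bounded_linear: "bounded_linear T"
    and bounded_operator_sum: "T (\<Sum>i\<in>I. f i) = (\<Sum>i\<in>I. T (f i))"
proof -
  interpret Vector_Spaces.linear sX sY T
    using assms by (simp add: bounded_operator_def)
  show "T (x + y) = T x + T y" "T (sX c x) = sY c (T x)" "T 0 = 0" "T (x - y) = T x - T y"
    "T (\<Sum>i\<in>I. f i) = (\<Sum>i\<in>I. T (f i))"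
    by (rule add scale zero diff sum)+
  show "bounded_linear T"
    using assms by (simp add: bounded_operator_def)
qed

lemma bounded_operator_compose:
  assumes "bounded_operator sX sY T" and "bounded_operator sY sZ U"
  shows "bounded_operator sX sZ (U \<circ> T)"
  using assms unfolding bounded_operator_def
  by (auto intro: Vector_Spaces.linear_compose bounded_linear_compose[unfolded comp_def[symmetric]])

lemma bounded_operator_minus:
  assumes "normed_space_over sX" and "normed_space_over sY"
    and T: "bounded_operator sX sY T" and U: "bounded_operator sX sY U"
  shows "bounded_operator sX sY (\<lambda>x. T x - U x)"
proof (rule bounded_operatorI[OF assms(1,2)])
  interpret Y: normed_space_over sY by fact
  show "T (x + y) - U (x + y) = T x - U x + (T y - U y)" for x y
    by (simp add: bounded_operator_add[OF T] bounded_operator_add[OF U])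
  show "T (sX c x) - U (sX c x) = sY c (T x - U x)" for c x
    by (simp add: bounded_operator_scale[OF T] bounded_operator_scale[OF U] Y.scale_right_diff_distrib)
  show "norm (T x - U x) \<le> onorm (\<lambda>x. T x - U x) * norm x" for x
    by (intro onorm bounded_linear_sub bounded_operator_bounded_linear[OF T]
      bounded_operator_bounded_linear[OF U])
qed

lemma operator_rank_le_card:
  assumes "normed_space_over sY" and "finite B" and "range L \<subseteq> module.span sY B"
  shows "operator_rank sY L \<le> enat (card B)"
proof -
  interpret normed_space_over sY by fact
  show ?thesis
    using assms dim_le_card unfolding operator_rank_def by auto
qed

lemma operator_rank_basis:
  assumes "normed_space_over sY" and "operator_rank sY L < enat n"
  obtains B where "finite B" "card B < n" "B \<subseteq> range L" "\<not> module.dependent sY B"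
    "range L \<subseteq> module.span sY B"
proof -
  interpret normed_space_over sY by fact
  obtain F where F: "finite F" "range L \<subseteq> span F" and dim: "dim (range L) < n"
    using assms(2) unfolding operator_rank_def by (auto split: if_splits)
  obtain B where B: "B \<subseteq> range L" "independent B" "range L \<subseteq> span B" "card B = dim (range L)"
    using basis_exists by blast
  then have "finite B"
    using independent_span_bound[OF F(1) B(2)] F(2) by blast
  with B dim that show ?thesis
    by simp
qed

lemma zero_operator:
  assumes "normed_space_over sX" and "normed_space_over sY" and "n \<ge> 1"
  shows "bounded_operator sX sY (\<lambda>_. 0)" and "operator_rank sY (\<lambda>_ :: 'c. 0) < enat n"
proof -
  interpret Y: normed_space_over sY by fact
  show "bounded_operator sX sY (\<lambda>_. 0)"
    by (rule bounded_operatorI[OF assms(1,2), where K = 0]) auto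
  have "operator_rank sY (\<lambda>_ :: 'c. 0) \<le> enat 0"
    using operator_rank_le_card[OF assms(2), of "{}" "\<lambda>_ :: 'c. 0"] by simp
  also have "\<dots> < enat n"
    using assms(3) by simp
  finally show "operator_rank sY (\<lambda>_ :: 'c. 0) < enat n" .
qed

context
  fixes sX :: "'k::real_or_complex_field \<Rightarrow> 'a::real_normed_vector \<Rightarrow> 'a"
    and sY :: "'k \<Rightarrow> 'b::real_normed_vector \<Rightarrow> 'b" and S :: "'a \<Rightarrow> 'b"
  assumes X: "normed_space_over sX" and Y: "normed_space_over sY"
    and S: "bounded_operator sX sY S"
begin

lemma approximation_number_le_onorm:
  assumes "bounded_operator sX sY L" and "operator_rank sY L < enat n"
  shows "approximation_number sX sY n S \<le> onorm (\<lambda>x. S x - L x)"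
  unfolding approximation_number_def
proof (rule cInf_lower)
  show "bdd_below {onorm (\<lambda>x. S x - L x) |L. bounded_operator sX sY L \<and> operator_rank sY L < enat n}"
  proof (rule bdd_belowI)
    fix r assume "r \<in> {onorm (\<lambda>x. S x - L x) |L. bounded_operator sX sY L \<and> operator_rank sY L < enat n}"
    then obtain L where "bounded_operator sX sY L" "r = onorm (\<lambda>x. S x - L x)"
      by blast
    then show "0 \<le> r"
      using S by (auto intro: onorm_pos_le bounded_linear_sub bounded_operator_bounded_linear)
  qed
qed (use assms in blast)

lemma approximation_number_le_norm:
  assumes "n \<ge> 1"
  shows "approximation_number sX sY n S \<le> onorm S"
  using approximation_number_le_onorm[OF zero_operator[OF X Y assms]] by simp

end

context
  fixes sX :: "'k::real_or_complex_field \<Rightarrow> 'a::real_normed_vector \<Rightarrow> 'a"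
    and sY :: "'k \<Rightarrow> 'b::real_normed_vector \<Rightarrow> 'b" and S :: "'a \<Rightarrow> 'b"
  assumes X: "normed_space_over sX" and Y: "normed_space_over sY"
    and S: "bounded_operator sX sY S"
begin

lemma approximation_number_nonneg:
  assumes "n \<ge> 1"
  shows "0 \<le> approximation_number sX sY n S"
  unfolding approximation_number_def
proof (rule cInf_greatest)
  show "{onorm (\<lambda>x. S x - L x) |L. bounded_operator sX sY L \<and> operator_rank sY L < enat n} \<noteq> {}"
    using zero_operator[OF X Y assms] by blast
  show "0 \<le> r" if "r \<in> {onorm (\<lambda>x. S x - L x) |L. bounded_operator sX sY L \<and> operator_rank sY L < enat n}" for r
    using that S by (auto intro: onorm_pos_le bounded_linear_sub bounded_operator_bounded_linear)
qed

lemma approximation_number_lessE: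
  assumes "n \<ge> 1" and "approximation_number sX sY n S < b"
  obtains L where "bounded_operator sX sY L" "operator_rank sY L < enat n" "onorm (\<lambda>x. S x - L x) < b"
proof -
  have "{onorm (\<lambda>x. S x - L x) |L. bounded_operator sX sY L \<and> operator_rank sY L < enat n} \<noteq> {}"
    using zero_operator[OF X Y assms(1)] by blast
  from cInf_lessD[OF this assms(2)[unfolded approximation_number_def]] show ?thesis
    using that by blast
qed

text \<open>
  Preimages of a basis of the range of \<open>L\<close> represent a basis of the quotient by the kernel.
\<close>

lemma kernel_codim:
  assumes L: "bounded_operator sX sY L" and "operator_rank sY L < enat n"
  shows "closed {x. L x = 0}" and "module.subspace sX {x. L x = 0}" and "codim sX {x. L x = 0} < enat n"
proof -
  interpret X: normed_space_over sX by (rule X)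
  interpret Y: normed_space_over sY by (rule Y)
  interpret L: Vector_Spaces.linear sX sY L
    using L by (simp add: bounded_operator_def)
  show "closed {x. L x = 0}"
    using linear_continuous_on[OF bounded_operator_bounded_linear[OF L], of UNIV]
    by (intro closed_Collect_eq) auto
  show "X.subspace {x. L x = 0}"
    by (rule L.subspace_kernel)
  obtain B where B: "finite B" "card B < n" "B \<subseteq> range L" "Y.independent B" "range L \<subseteq> Y.span B"
    using operator_rank_basis[OF Y assms(2)] by blast
  obtain p where p: "\<And>b. b \<in> B \<Longrightarrow> L (p b) = b"
    using B(3) by (metis f_inv_into_f subsetD)
  have inj: "inj_on p B"
    using p by (rule inj_on_inverseI)
  have sum_p: "L (\<Sum>q\<in>p ` B. sX (c q) q) = (\<Sum>b\<in>B. sY (c (p b)) b)" for c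
    by (simp add: L.sum L.scale sum.reindex[OF inj] p)
  have "quotient_basis sX {x. L x = 0} (p ` B)"
    unfolding quotient_basis_def
  proof (intro conjI allI impI ballI)
    show "finite (p ` B)"
      using B(1) by simp
  next
    fix x
    have "L x \<in> Y.span B"
      using B(5) by auto
    then obtain c where c: "L x = (\<Sum>b\<in>B. sY (c b) b)"
      using Y.span_finite[OF B(1)] by auto
    have "L (\<Sum>q\<in>p ` B. sX (c (L q)) q) = L x"
      unfolding sum_p c by (simp add: p)
    then have "x - (\<Sum>q\<in>p ` B. sX (c (L q)) q) \<in> {x. L x = 0}"
      by (simp add: L.diff)
    then show "\<exists>d. x - (\<Sum>q\<in>p ` B. sX (d q) q) \<in> {x. L x = 0}"
      by (intro exI[of _ "\<lambda>q. c (L q)"])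
  next
    fix c q assume "(\<Sum>q\<in>p ` B. sX (c q) q) \<in> {x. L x = 0}" and q: "q \<in> p ` B"
    then have "(\<Sum>b\<in>B. sY (c (p b)) b) = 0"
      by (simp add: sum_p)
    then have "\<forall>b\<in>B. c (p b) = 0"
      using Y.independentD[OF B(4) B(1) order_refl, of "\<lambda>b. c (p b)"] by blast
    then show "c q = 0"
      using q by auto
  qed
  then have "codim sX {x. L x = 0} \<le> enat (card (p ` B))"
    unfolding codim_def by (intro INF_lower) simp
  also have "\<dots> < enat n"
    using B(2) by (simp add: card_image[OF inj])
  finally show "codim sX {x. L x = 0} < enat n" .
qed

lemma gelfand_number_le_approximation_number:
  assumes "n \<ge> 1"
  shows "gelfand_number sX n S \<le> approximation_number sX sY n S"
  unfolding approximation_number_def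
proof (rule cInf_greatest)
  interpret X: normed_space_over sX by (rule X)
  show "{onorm (\<lambda>x. S x - L x) |L. bounded_operator sX sY L \<and> operator_rank sY L < enat n} \<noteq> {}"
    using zero_operator[OF X Y assms] by blast
  fix r assume "r \<in> {onorm (\<lambda>x. S x - L x) |L. bounded_operator sX sY L \<and> operator_rank sY L < enat n}"
  then obtain L where L: "bounded_operator sX sY L" "operator_rank sY L < enat n"
    and r: "r = onorm (\<lambda>x. S x - L x)"
    by blast
  let ?N = "{onorm_on M S | M. closed M \<and> X.subspace M \<and> codim sX M < enat n}"
  have bdd: "bdd_above ((\<lambda>x. norm (S x) / norm x) ` M)" for M
    by (rule bdd_aboveI2[of _ _ "onorm S"]) (rule le_onorm[OF bounded_operator_bounded_linear[OF S]])
  have "bdd_below ?N"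
  proof (rule bdd_belowI)
    fix r assume "r \<in> ?N"
    then obtain M where M: "X.subspace M" "r = onorm_on M S"
      by blast
    have "norm (S 0) / norm (0 :: 'a) \<le> r"
      unfolding M(2) onorm_on_def using X.subspace_0[OF M(1)] bdd by (rule cSUP_upper)
    then show "0 \<le> r"
      by simp
  qed
  then have "gelfand_number sX n S \<le> onorm_on {x. L x = 0} S"
    unfolding gelfand_number_def using kernel_codim[OF L] by (intro cInf_lower) auto
  also have "\<dots> \<le> r"
    unfolding onorm_on_def
  proof (rule cSUP_least)
    show "{x. L x = 0} \<noteq> {}"
      using bounded_operator_zero[OF L(1)] by blast
    fix x assume "x \<in> {x. L x = 0}"
    then have "norm (S x) / norm x = norm (S x - L x) / norm x"
      by simp
    also have "\<dots> \<le> r"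
      unfolding r using S L by (intro le_onorm bounded_linear_sub bounded_operator_bounded_linear)
    finally show "norm (S x) / norm x \<le> r" .
  qed
  finally show "gelfand_number sX n S \<le> r" .
qed

lemma approximation_number_le_hilbert_number:
  assumes A: "bounded_operator scale_ell2 sX A" "A \<noteq> (\<lambda>_. 0)"
    and B: "bounded_operator sY scale_ell2 B" "B \<noteq> (\<lambda>_. 0)"
    and "n \<ge> 1"
  shows "approximation_number scale_ell2 scale_ell2 n (B \<circ> S \<circ> A) \<le> onorm B * onorm A * hilbert_number sX sY n S"
proof -
  note lin = bounded_operator_bounded_linear
  have pos: "onorm B > 0" "onorm A > 0"
    using A B by (auto simp: onorm_pos_lt lin fun_eq_iff)
  have "bdd_above (hilbert_ratios sX sY n S)"
  proof (rule bdd_aboveI)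
    fix r assume "r \<in> hilbert_ratios sX sY n S"
    then obtain A B where A: "bounded_operator scale_ell2 sX A" "A \<noteq> (\<lambda>_. 0)"
      and B: "bounded_operator sY scale_ell2 B" "B \<noteq> (\<lambda>_. 0)"
      and r: "r = approximation_number scale_ell2 scale_ell2 n (B \<circ> S \<circ> A) / (onorm B * onorm A)"
      unfolding hilbert_ratios_def by blast
    have pos: "onorm B > 0" "onorm A > 0"
      using A B by (auto simp: onorm_pos_lt lin fun_eq_iff)
    have "approximation_number scale_ell2 scale_ell2 n (B \<circ> S \<circ> A) \<le> onorm (B \<circ> S \<circ> A)"
      using bounded_operator_compose[OF A(1) bounded_operator_compose[OF S B(1)]] \<open>n \<ge> 1\<close>
      by (intro approximation_number_le_norm normed_space_over_ell2) (simp_all add: comp_assoc)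
    also have "\<dots> \<le> onorm (B \<circ> S) * onorm A"
      using A B S by (intro onorm_compose lin bounded_operator_compose)
    also have "\<dots> \<le> (onorm B * onorm S) * onorm A"
      using A B S pos by (intro mult_right_mono onorm_compose lin) auto
    finally show "r \<le> onorm S"
      unfolding r using pos by (simp add: field_simps)
  qed
  moreover have "approximation_number scale_ell2 scale_ell2 n (B \<circ> S \<circ> A) / (onorm B * onorm A) \<in> hilbert_ratios sX sY n S"
    unfolding hilbert_ratios_def using A B by blast
  ultimately have "approximation_number scale_ell2 scale_ell2 n (B \<circ> S \<circ> A) / (onorm B * onorm A) \<le> hilbert_number sX sY n S"
    unfolding hilbert_number_def by (auto intro: cSup_upper)
  then show ?thesis
    using pos by (simp add: field_simps)
qed

end

section \<open>Gaussian elimination with complete pivoting\<close>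

text \<open>
  \<open>R\<close> is the remainder after \<open>m\<close> steps. The vectors \<open>g k\<close> and the functionals \<open>f k\<close> are the columns
  and the rows that have been eliminated; evaluated at the \<open>y\<close> and the \<open>x\<close>, they form a lower
  triangular matrix with diagonal entries of size at least \<open>c\<close> and a unit upper triangular one.
\<close>

lemma complete_pivoting:
  fixes sX :: "'k::real_or_complex_field \<Rightarrow> 'a::real_normed_vector \<Rightarrow> 'a"
    and sY :: "'k \<Rightarrow> 'b::real_normed_vector \<Rightarrow> 'b" and S :: "'a \<Rightarrow> 'b"
  assumes X: "normed_space_over sX" and Y: "normed_space_over sY"
    and S: "bounded_operator sX sY S"
    and c: "0 < c" "c < approximation_number sX sY n S" and "m \<le> n"
  shows "\<exists>R x f g y. bounded_operator sX sY R \<and> (\<forall>z. S z = R z + (\<Sum>k<m. sY (f k z) (g k))) \<and>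
    (\<forall>k<m. bounded_operator sX (*) (f k) \<and> bounded_operator sY (*) (y k) \<and>
       norm (x k) \<le> 1 \<and> (\<forall>z. norm (y k z) \<le> norm z) \<and> R (x k) = 0 \<and> (\<forall>z. y k (R z) = 0) \<and>
       f k (x k) = 1 \<and> c \<le> norm (y k (g k)) \<and> (\<forall>j<k. f k (x j) = 0 \<and> y j (g k) = 0))"
  using \<open>m \<le> n\<close>
proof (induction m)
  case 0
  show ?case
    using S by (intro exI[of _ S]) auto
next
  case (Suc m)
  interpret X: normed_space_over sX by (rule X)
  interpret Y: normed_space_over sY by (rule Y)
  have "m \<le> n"
    using Suc.prems by simp
  from Suc.IH[OF this] obtain R x f g y where R: "bounded_operator sX sY R"
    and split: "\<And>z. S z = R z + (\<Sum>k<m. sY (f k z) (g k))"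
    and old: "\<And>k. k < m \<Longrightarrow> bounded_operator sX (*) (f k) \<and> bounded_operator sY (*) (y k) \<and>
       norm (x k) \<le> 1 \<and> (\<forall>z. norm (y k z) \<le> norm z) \<and> R (x k) = 0 \<and> (\<forall>z. y k (R z) = 0) \<and>
       f k (x k) = 1 \<and> c \<le> norm (y k (g k)) \<and> (\<forall>j<k. f k (x j) = 0 \<and> y j (g k) = 0)"
    by blast
  note R_lin = bounded_operator_bounded_linear[OF R]
  have "c < onorm R"
  proof -
    let ?L = "\<lambda>z. S z - R z"
    have "range ?L \<subseteq> Y.span (g ` {..<m})"
    proof (rule image_subsetI)
      fix z
      have "(\<Sum>k<m. sY (f k z) (g k)) \<in> Y.span (g ` {..<m})"
        by (intro Y.span_sum Y.span_scale) (simp add: Y.span_base)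
      then show "?L z \<in> Y.span (g ` {..<m})"
        by (simp add: split)
    qed
    then have "operator_rank sY ?L \<le> enat (card (g ` {..<m}))"
      by (intro operator_rank_le_card Y) simp
    also have "\<dots> \<le> enat m"
      using card_image_le[of "{..<m}" g] by simp
    also have "\<dots> < enat n"
      using Suc.prems by simp
    finally have "approximation_number sX sY n S \<le> onorm (\<lambda>z. S z - ?L z)"
      by (intro approximation_number_le_onorm[OF X Y S] bounded_operator_minus[OF X Y S R])
    then show ?thesis
      using c(2) by simp
  qed
  then obtain z0 where z0: "c * norm z0 < norm (R z0)"
    using onorm_bound[of c R] c(1) by (meson not_le less_imp_le)
  then have "z0 \<noteq> 0"
    using bounded_operator_zero[OF R] by auto
  \<comment> \<open>the new pivot is \<open>p = y0 (R x0)\<close>\<close>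
  define x0 where "x0 = z0 /\<^sub>R norm z0"
  have x0: "norm x0 = 1"
    using \<open>z0 \<noteq> 0\<close> by (simp add: x0_def)
  have "R x0 = R z0 /\<^sub>R norm z0"
    unfolding x0_def by (rule linear_scale[OF bounded_linear.linear[OF R_lin]])
  then have Rx0: "c < norm (R x0)"
    using z0 \<open>z0 \<noteq> 0\<close> by (simp add: field_simps)
  obtain y0 where y0: "bounded_operator sY (*) y0" "\<And>z. norm (y0 z) \<le> norm z" "norm (y0 (R x0)) = norm (R x0)"
    using norming_functional[OF Y, of "R x0"] by blast
  define p where "p = y0 (R x0)"
  have p: "p \<noteq> 0"
    using Rx0 y0(3) c(1) by (auto simp: p_def)
  define f0 where "f0 z = y0 (R z) / p" for z
  \<comment> \<open>subtract a rank-one operator so that the remainder vanishes at \<open>x0\<close> and under \<open>y0\<close>\<close>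
  define R0 where "R0 z = R z - sY (f0 z) (R x0)" for z
  have f0_bounded: "norm (f0 z) \<le> onorm R / norm p * norm z" for z
  proof -
    have "norm (y0 (R z)) \<le> onorm R * norm z"
      by (rule order_trans[OF y0(2) onorm[OF R_lin]])
    then show ?thesis
      using p by (simp add: f0_def norm_divide field_simps)
  qed
  note Radd = bounded_operator_add[OF R] and Rscale = bounded_operator_scale[OF R]
  note yadd = bounded_operator_add[OF y0(1)] and yscale = bounded_operator_scale[OF y0(1)]
  have f0_add: "f0 (z + w) = f0 z + f0 w" and f0_scale: "f0 (sX a z) = a * f0 z" for z w a
    by (simp_all add: f0_def Radd Rscale yadd yscale add_divide_distrib)
  have f0: "bounded_operator sX (*) f0"
    by (rule bounded_operatorI[OF X normed_space_over_self f0_add f0_scale f0_bounded])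
  have R0: "bounded_operator sX sY R0"
  proof (rule bounded_operatorI[OF X Y])
    show "R0 (z + w) = R0 z + R0 w" for z w
      by (simp add: R0_def Radd f0_add Y.scale_left_distrib)
    show "R0 (sX a z) = sY a (R0 z)" for a z
      by (simp add: R0_def Rscale f0_scale Y.scale_right_diff_distrib)
    show "norm (R0 z) \<le> (onorm R + onorm R / norm p * norm (R x0)) * norm z" for z
    proof -
      have "norm (R0 z) \<le> norm (R z) + norm (f0 z) * norm (R x0)"
        unfolding R0_def by (rule order_trans[OF norm_triangle_ineq4]) (simp add: Y.norm_scale)
      also have "\<dots> \<le> onorm R * norm z + (onorm R / norm p * norm z) * norm (R x0)"
        by (intro add_mono mult_right_mono onorm[OF R_lin] f0_bounded) simp
      finally show ?thesis
        by (simp add: algebra_simps)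
    qed
  qed
  have f0_old: "f0 (x j) = 0" if "j < m" for j
    using old[OF that] bounded_operator_zero[OF y0(1)] by (simp add: f0_def)
  have f0_x0: "f0 x0 = 1"
    using p by (simp add: f0_def p_def)
  have R0_old: "R0 (x j) = 0" if "j < m" for j
    using old[OF that] f0_old[OF that] by (simp add: R0_def)
  have R0_x0: "R0 x0 = 0"
    by (simp add: R0_def f0_x0)
  have y_R0: "y j (R0 z) = 0" if "j < m" for j z
  proof -
    have yj: "bounded_operator sY (*) (y j)"
      using old[OF that] by blast
    show ?thesis
      using old[OF that] by (simp add: R0_def bounded_operator_diff[OF yj] bounded_operator_scale[OF yj])
  qed
  have y0_R0: "y0 (R0 z) = 0" for z
    using p by (simp add: R0_def bounded_operator_diff[OF y0(1)] yscale f0_def flip: p_def)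
  show ?case
  proof (rule exI[of _ R0], rule exI[of _ "x(m := x0)"], rule exI[of _ "f(m := f0)"],
      rule exI[of _ "g(m := R x0)"], rule exI[of _ "y(m := y0)"], intro conjI allI impI)
    show "bounded_operator sX sY R0"
      by (rule R0)
    show "S z = R0 z + (\<Sum>k<Suc m. sY ((f(m := f0)) k z) ((g(m := R x0)) k))" for z
      by (simp add: split R0_def)
  next
    fix k assume "k < Suc m"
    then consider "k = m" | "k < m"
      by linarith
    note cases = this
    show "bounded_operator sX (*) ((f(m := f0)) k)" "bounded_operator sY (*) ((y(m := y0)) k)"
      "norm ((x(m := x0)) k) \<le> 1" "norm ((y(m := y0)) k z) \<le> norm z" "R0 ((x(m := x0)) k) = 0"
      "(y(m := y0)) k (R0 w) = 0" "(f(m := f0)) k ((x(m := x0)) k) = 1"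
      "c \<le> norm ((y(m := y0)) k ((g(m := R x0)) k))" for z w
      using cases
      by (cases; use old f0 y0 x0 R0_old R0_x0 y_R0 y0_R0 f0_x0 Rx0 in simp)+
    fix j assume "j < k"
    show "(f(m := f0)) k ((x(m := x0)) j) = 0" "(y(m := y0)) j ((g(m := R x0)) k) = 0"
      using cases by (cases; use old f0_old \<open>j < k\<close> in simp)+
  qed
qed

section \<open>Determinants and approximation numbers on the sequence space\<close>

text \<open>The sequence \<open>(u\<^sub>0, \<dots>, u\<^sub>n\<^sub>-\<^sub>1, 0, 0, \<dots>)\<close>.\<close>

lift_definition finite_ell2 :: "nat \<Rightarrow> (nat \<Rightarrow> 'k::real_normed_field) \<Rightarrow> 'k ell2" is
  "\<lambda>n u i. if i < n then u i else 0"
  by (rule summable_finite[of "{..<_}"]) auto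

lemma norm_finite_ell2: "norm (finite_ell2 n u) = sqrt (\<Sum>i<n. (norm (u i))\<^sup>2)"
proof transfer
  fix n and u :: "nat \<Rightarrow> 'a"
  have "(\<Sum>i. (norm (if i < n then u i else 0))\<^sup>2) = (\<Sum>i<n. (norm (if i < n then u i else 0))\<^sup>2)"
    by (rule suminf_finite) auto
  then show "sqrt (\<Sum>i. (norm (if i < n then u i else 0))\<^sup>2) = sqrt (\<Sum>i<n. (norm (u i))\<^sup>2)"
    by simp
qed

lemma partial_norm_ell2_le: "sqrt (\<Sum>i<n. (norm (Rep_ell2 \<xi> i))\<^sup>2) \<le> norm \<xi>"
  by transfer (intro real_sqrt_le_mono sum_le_suminf, auto)

lemma Rep_finite_ell2: "Rep_ell2 (finite_ell2 n u) i = (if i < n then u i else 0)"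
  by transfer simp

lemma Rep_ell2_add: "Rep_ell2 (x + y) i = Rep_ell2 x i + Rep_ell2 y i"
  by transfer simp

lemma Rep_ell2_scale: "Rep_ell2 (scale_ell2 c x) i = c * Rep_ell2 x i"
  by transfer simp

lemma Rep_ell2_sum: "Rep_ell2 (\<Sum>j\<in>J. f j) i = (\<Sum>j\<in>J. Rep_ell2 (f j) i)"
proof (induction J rule: infinite_finite_induct)
  case (insert j J)
  then show ?case
    by (simp add: Rep_ell2_add)
qed (simp_all add: zero_ell2.rep_eq)

text \<open>The standard unit vectors, indexed from \<open>0\<close>.\<close>

definition unit_ell2 :: "nat \<Rightarrow> 'k::real_normed_field ell2" where
  "unit_ell2 j = finite_ell2 (Suc j) (\<lambda>i. if i = j then 1 else 0)"

lemma Rep_unit_ell2: "Rep_ell2 (unit_ell2 j) i = (if i = j then 1 else 0)"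
  by (simp add: unit_ell2_def Rep_finite_ell2)

lemma finite_ell2_eq_sum: "finite_ell2 n u = (\<Sum>j<n. scale_ell2 (u j) (unit_ell2 j))"
  by (rule Rep_ell2_inject[THEN iffD1], rule ext)
     (simp add: Rep_finite_ell2 Rep_ell2_sum Rep_ell2_scale Rep_unit_ell2 if_distrib cong: if_cong)

text \<open>
  The absolute value of a leading principal minor of the matrix of \<open>T\<close> is at most the product of the
  approximation numbers. The bounds \<open>b k\<close> are strictly larger because the infimum in the definition of
  the approximation numbers is not claimed to be attained.
\<close>

lemma norm_det_le_prod_approximation_numbers:
  fixes T :: "'k::real_or_complex_field ell2 \<Rightarrow> 'k ell2"
  assumes T: "bounded_operator scale_ell2 scale_ell2 T"
    and b: "\<And>k. k < n \<Longrightarrow> approximation_number scale_ell2 scale_ell2 (Suc k) T < b k"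
  shows "norm (det (mat n n (\<lambda>(i, j). Rep_ell2 (T (unit_ell2 j)) i))) \<le> (\<Prod>k<n. b k)"
proof -
  interpret E: normed_space_over "scale_ell2 :: 'k \<Rightarrow> _"
    by (rule normed_space_over_ell2)
  have apply_finite: "U (finite_ell2 n u) = (\<Sum>j<n. scale_ell2 (u j) (U (unit_ell2 j)))"
    if "bounded_operator scale_ell2 scale_ell2 U" for U :: "'k ell2 \<Rightarrow> 'k ell2" and u
    by (simp add: finite_ell2_eq_sum bounded_operator_sum[OF that] bounded_operator_scale[OF that])
  \<comment> \<open>\<open>F\<close> consists of equations for the kernel of an almost optimal operator of rank at most \<open>k\<close>\<close>
  define suits where "suits k F \<longleftrightarrow> finite F \<and> card F \<le> k \<and>
      (\<forall>u. (\<forall>a\<in>F. (\<Sum>j<n. a j * u j) = 0) \<longrightarrow> (\<Sum>j<n. (norm (u j))\<^sup>2) = 1 \<longrightarrow>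
        sqrt (\<Sum>i<n. (norm (\<Sum>j<n. Rep_ell2 (T (unit_ell2 j)) i * u j))\<^sup>2) \<le> b k)" for k F
  have "\<exists>F. suits k F" if "k < n" for k
  proof -
    have "Suc k \<ge> 1"
      by simp
    obtain L where L: "bounded_operator scale_ell2 scale_ell2 L" "operator_rank scale_ell2 L < enat (Suc k)"
      "onorm (\<lambda>\<xi>. T \<xi> - L \<xi>) < b k"
      by (rule approximation_number_lessE[OF normed_space_over_ell2 normed_space_over_ell2 T
        \<open>Suc k \<ge> 1\<close> b[OF \<open>k < n\<close>]])
    obtain B where B: "finite B" "card B < Suc k" "B \<subseteq> range L" "E.independent B" "range L \<subseteq> E.span B"
      by (rule operator_rank_basis[OF normed_space_over_ell2 L(2)])
    have "\<exists>c. L (unit_ell2 j) = (\<Sum>w\<in>B. scale_ell2 (c w) w)" for j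
      using B(5) E.span_finite[OF B(1)] by auto
    then obtain c where c: "\<And>j. L (unit_ell2 j) = (\<Sum>w\<in>B. scale_ell2 (c j w) w)"
      by metis
    define F where "F = (\<lambda>w j. c j w) ` B"
    have "finite F"
      using B(1) by (simp add: F_def)
    moreover have "card F \<le> k"
      using card_image_le[OF B(1), of "\<lambda>w j. c j w"] B(2) by (simp add: F_def)
    moreover have "sqrt (\<Sum>i<n. (norm (\<Sum>j<n. Rep_ell2 (T (unit_ell2 j)) i * u j))\<^sup>2) \<le> b k"
      if u: "\<forall>a\<in>F. (\<Sum>j<n. a j * u j) = 0" "(\<Sum>j<n. (norm (u j))\<^sup>2) = 1" for u
    proof -
      let ?\<xi> = "finite_ell2 n u"
      have "L ?\<xi> = (\<Sum>j<n. \<Sum>w\<in>B. scale_ell2 (u j * c j w) w)"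
        by (simp add: apply_finite[OF L(1)] c E.scale_sum_right)
      also have "\<dots> = (\<Sum>w\<in>B. scale_ell2 (\<Sum>j<n. c j w * u j) w)"
        by (subst sum.swap) (simp add: E.scale_sum_left mult.commute)
      also have "\<dots> = 0"
        using u(1) by (simp add: F_def)
      finally have "L ?\<xi> = 0" .
      have "(\<Sum>j<n. Rep_ell2 (T (unit_ell2 j)) i * u j) = Rep_ell2 (T ?\<xi>) i" for i
        by (simp add: apply_finite[OF T] Rep_ell2_sum Rep_ell2_scale mult.commute)
      then have "sqrt (\<Sum>i<n. (norm (\<Sum>j<n. Rep_ell2 (T (unit_ell2 j)) i * u j))\<^sup>2) \<le> norm (T ?\<xi> - L ?\<xi>)"
        using partial_norm_ell2_le[where \<xi> = "T ?\<xi>" and n = n] \<open>L ?\<xi> = 0\<close> by simp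
      also have "\<dots> \<le> onorm (\<lambda>\<xi>. T \<xi> - L \<xi>) * norm ?\<xi>"
        using T L(1) by (intro onorm bounded_linear_sub bounded_operator_bounded_linear)
      also have "\<dots> \<le> b k"
        using L(3) u(2) by (simp add: norm_finite_ell2)
      finally show ?thesis .
    qed
    ultimately show ?thesis
      unfolding suits_def by blast
  qed
  then obtain F where "\<And>k. k < n \<Longrightarrow> suits k (F k)"
    by metis
  then show ?thesis
    unfolding suits_def by (intro det_le_prod_of_kernels[of n F]) blast+
qed

section \<open>Approximation numbers are bounded by Hilbert numbers\<close>

lemma hilbert_number_nonneg:
  assumes X: "normed_space_over sX" and Y: "normed_space_over sY"
    and S: "bounded_operator sX sY S" and "n \<ge> 1"
  shows "0 \<le> hilbert_number sX sY n S"
proof (cases "hilbert_ratios sX sY n S = {}")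
  case False
  then obtain A B where A: "bounded_operator scale_ell2 sX A" "A \<noteq> (\<lambda>_. 0)"
    and B: "bounded_operator sY scale_ell2 B" "B \<noteq> (\<lambda>_. 0)"
    unfolding hilbert_ratios_def by blast
  have "0 \<le> approximation_number scale_ell2 scale_ell2 n (B \<circ> S \<circ> A)"
    using bounded_operator_compose[OF A(1) bounded_operator_compose[OF S B(1)]] \<open>n \<ge> 1\<close>
    by (intro approximation_number_nonneg normed_space_over_ell2) (simp_all add: comp_assoc)
  also have "\<dots> \<le> (onorm B * onorm A) * hilbert_number sX sY n S"
    by (rule approximation_number_le_hilbert_number[OF X Y S A B \<open>n \<ge> 1\<close>])
  finally have "0 \<le> (onorm B * onorm A) * hilbert_number sX sY n S" .
  moreover have "0 < onorm B * onorm A"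
    using A B by (auto simp: onorm_pos_lt bounded_operator_bounded_linear fun_eq_iff)
  ultimately show ?thesis
    by (simp add: zero_le_mult_iff)
qed (simp add: hilbert_number_def)

lemma sum_norm_le_sqrt_mult_norm_ell2:
  "(\<Sum>i<n. norm (Rep_ell2 \<xi> i)) \<le> sqrt (real n) * norm \<xi>"
proof -
  have "(\<Sum>i<n. \<bar>1\<bar> * \<bar>norm (Rep_ell2 \<xi> i)\<bar>) \<le>
      L2_set (\<lambda>_. 1) {..<n} * L2_set (\<lambda>i. norm (Rep_ell2 \<xi> i)) {..<n}"
    by (rule L2_set_mult_ineq)
  also have "\<dots> = sqrt (real n) * sqrt (\<Sum>i<n. (norm (Rep_ell2 \<xi> i))\<^sup>2)"
    by (simp add: L2_set_def)
  also have "\<dots> \<le> sqrt (real n) * norm \<xi>"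
    by (intro mult_left_mono partial_norm_ell2_le) simp
  finally show ?thesis
    by simp
qed

lemma synthesis_operator:
  fixes sX :: "'k::real_or_complex_field \<Rightarrow> 'a::real_normed_vector \<Rightarrow> 'a"
  assumes X: "normed_space_over sX" and x: "\<And>k. k < n \<Longrightarrow> norm (x k) \<le> 1"
    and A_def: "A = (\<lambda>\<xi>. \<Sum>k<n. sX (Rep_ell2 \<xi> k) (x k))"
  shows "bounded_operator scale_ell2 sX A" and "onorm A \<le> sqrt (real n)"
    and "\<And>j. j < n \<Longrightarrow> A (unit_ell2 j) = x j"
proof -
  interpret X: normed_space_over sX by (rule X)
  have bound: "norm (A \<xi>) \<le> sqrt (real n) * norm \<xi>" for \<xi>
  proof -
    have "norm (A \<xi>) \<le> (\<Sum>k<n. norm (Rep_ell2 \<xi> k))"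
      unfolding A_def using x by (intro sum_norm_le) (simp add: X.norm_scale mult_left_le)
    also have "\<dots> \<le> sqrt (real n) * norm \<xi>"
      by (rule sum_norm_le_sqrt_mult_norm_ell2)
    finally show ?thesis .
  qed
  show "bounded_operator scale_ell2 sX A"
  proof (rule bounded_operatorI[OF normed_space_over_ell2 X _ _ bound])
    show "A (\<xi> + \<eta>) = A \<xi> + A \<eta>" for \<xi> \<eta>
      by (simp add: A_def Rep_ell2_add X.scale_left_distrib sum.distrib)
    show "A (scale_ell2 c \<xi>) = sX c (A \<xi>)" for c \<xi>
      by (simp add: A_def Rep_ell2_scale X.scale_sum_right)
  qed
  show "onorm A \<le> sqrt (real n)"
    by (intro onorm_bound bound) simp
  show "A (unit_ell2 j) = x j" if "j < n" for j
  proof -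
    have "A (unit_ell2 j) = (\<Sum>k<n. if k = j then x k else 0)"
      unfolding A_def by (intro sum.cong) (auto simp: Rep_unit_ell2)
    then show ?thesis
      using that by simp
  qed
qed

lemma analysis_operator:
  fixes sY :: "'k::real_or_complex_field \<Rightarrow> 'b::real_normed_vector \<Rightarrow> 'b"
  assumes Y: "normed_space_over sY" and y: "\<And>k. k < n \<Longrightarrow> bounded_operator sY (*) (y k)"
    and y_norm: "\<And>k z. k < n \<Longrightarrow> norm (y k z) \<le> norm z"
    and B_def: "B = (\<lambda>z. finite_ell2 n (\<lambda>k. y k z))"
  shows "bounded_operator sY scale_ell2 B" and "onorm B \<le> sqrt (real n)"
proof -
  have bound: "norm (B z) \<le> sqrt (real n) * norm z" for z
  proof -
    have "(\<Sum>k<n. (norm (y k z))\<^sup>2) \<le> (\<Sum>k<n. (norm z)\<^sup>2)"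
      by (intro sum_mono power_mono y_norm) auto
    then have "norm (B z) \<le> sqrt (real n * (norm z)\<^sup>2)"
      unfolding B_def norm_finite_ell2 by (intro real_sqrt_le_mono) simp
    then show ?thesis
      by (simp add: real_sqrt_mult)
  qed
  show "bounded_operator sY scale_ell2 B"
  proof (rule bounded_operatorI[OF Y normed_space_over_ell2 _ _ bound])
    show "B (z + w) = B z + B w" for z w
      unfolding B_def by (intro Rep_ell2_inject[THEN iffD1] ext)
        (simp add: Rep_ell2_add Rep_finite_ell2 bounded_operator_add[OF y])
    show "B (sY c z) = scale_ell2 c (B z)" for c z
      unfolding B_def by (intro Rep_ell2_inject[THEN iffD1] ext)
        (simp add: Rep_ell2_scale Rep_finite_ell2 bounded_operator_scale[OF y])
  qed
  show "onorm B \<le> sqrt (real n)"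
    by (intro onorm_bound bound) simp
qed

text \<open>
  With \<open>c\<close> close to \<open>a\<^sub>n(S)\<close> and \<open>b k\<close> close to \<open>n h\<^sub>k\<^sub>+\<^sub>1(S)\<close>, this is
  \<open>a\<^sub>n(S)\<^sup>n \<le> n\<^sup>n h\<^sub>1(S) \<cdots> h\<^sub>n(S)\<close>.
\<close>

lemma power_le_prod_hilbert_numbers:
  fixes sX :: "'k::real_or_complex_field \<Rightarrow> 'a::real_normed_vector \<Rightarrow> 'a"
    and sY :: "'k \<Rightarrow> 'b::real_normed_vector \<Rightarrow> 'b" and S :: "'a \<Rightarrow> 'b"
  assumes X: "normed_space_over sX" and Y: "normed_space_over sY"
    and S: "bounded_operator sX sY S" and "n \<ge> 1"
    and c: "0 < c" "c < approximation_number sX sY n S"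
    and b: "\<And>k. k < n \<Longrightarrow> real n * hilbert_number sX sY (Suc k) S < b k"
  shows "c ^ n \<le> (\<Prod>k<n. b k)"
proof -
  interpret Y: normed_space_over sY by (rule Y)
  obtain R x f g y where split: "\<And>z. S z = R z + (\<Sum>k<n. sY (f k z) (g k))"
    and piv: "\<And>k. k < n \<Longrightarrow> bounded_operator sX (*) (f k) \<and> bounded_operator sY (*) (y k) \<and>
       norm (x k) \<le> 1 \<and> (\<forall>z. norm (y k z) \<le> norm z) \<and> R (x k) = 0 \<and> (\<forall>z. y k (R z) = 0) \<and>
       f k (x k) = 1 \<and> c \<le> norm (y k (g k)) \<and> (\<forall>j<k. f k (x j) = 0 \<and> y j (g k) = 0)"
    using complete_pivoting[OF X Y S c order_refl] by blast
  define A where "A = (\<lambda>\<xi>. \<Sum>k<n. sX (Rep_ell2 \<xi> k) (x k))"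
  define B where "B = (\<lambda>z. finite_ell2 n (\<lambda>k. y k z))"
  have x: "norm (x k) \<le> 1" and y: "bounded_operator sY (*) (y k)" and y_norm: "norm (y k z) \<le> norm z"
    and f: "bounded_operator sX (*) (f k)" and y_R: "y k (R w) = 0"
    and f_diag: "f k (x k) = 1" and g_diag: "c \<le> norm (y k (g k))"
    if "k < n" for k z w
    using piv[OF that] by blast+
  have f_upper: "f k (x j) = 0" and g_lower: "y j (g k) = 0" if "j < k" "k < n" for j k
    using piv[OF that(2)] that(1) by blast+
  have A: "bounded_operator scale_ell2 sX A" "onorm A \<le> sqrt (real n)"
    and A_unit: "\<And>j. j < n \<Longrightarrow> A (unit_ell2 j) = x j"
    by (rule synthesis_operator[OF X x A_def]; assumption)+
  have B: "bounded_operator sY scale_ell2 B" "onorm B \<le> sqrt (real n)"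
    by (rule analysis_operator[OF Y y y_norm B_def]; assumption)+
  have n0: "0 < n"
    using \<open>n \<ge> 1\<close> by simp
  have "A (unit_ell2 0) \<noteq> 0"
  proof
    assume "A (unit_ell2 0) = 0"
    moreover have "A (unit_ell2 0) = x 0"
      by (rule A_unit[OF n0])
    ultimately have "f 0 (x 0) = 0"
      using bounded_operator_zero[OF f[OF n0]] by simp
    then show False
      using f_diag[OF n0] by simp
  qed
  then have A0: "A \<noteq> (\<lambda>_. 0)"
    by auto
  have "Rep_ell2 (B (g 0)) 0 \<noteq> 0"
    using g_diag[OF n0] c(1) n0 by (auto simp: B_def Rep_finite_ell2)
  then have B0: "B \<noteq> (\<lambda>_. 0)"
    by (auto simp: zero_ell2.rep_eq)
  let ?T = "B \<circ> S \<circ> A"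
  have T: "bounded_operator scale_ell2 scale_ell2 ?T"
    by (intro bounded_operator_compose[OF A(1)] bounded_operator_compose[OF S B(1)])
  have T_b: "approximation_number scale_ell2 scale_ell2 (Suc k) ?T < b k" if "k < n" for k
  proof -
    have "onorm B * onorm A \<le> sqrt (real n) * sqrt (real n)"
      using A B by (intro mult_mono onorm_pos_le bounded_operator_bounded_linear[OF A(1)]) auto
    then have le: "onorm B * onorm A \<le> real n"
      by simp
    have "approximation_number scale_ell2 scale_ell2 (Suc k) ?T
        \<le> onorm B * onorm A * hilbert_number sX sY (Suc k) S"
      by (rule approximation_number_le_hilbert_number[OF X Y S A(1) A0 B(1) B0]) simp
    also have "\<dots> \<le> real n * hilbert_number sX sY (Suc k) S"
      by (intro mult_right_mono le hilbert_number_nonneg[OF X Y S]) simp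
    also have "\<dots> < b k"
      by (rule b[OF that])
    finally show ?thesis .
  qed
  let ?G = "mat n n (\<lambda>(i, j). Rep_ell2 (?T (unit_ell2 j)) i)"
  \<comment> \<open>the remainder \<open>R\<close> is annihilated by all \<open>y i\<close>, so it does not contribute to \<open>G\<close>\<close>
  define Lo where "Lo = mat n n (\<lambda>(i, k). y i (g k))"
  define Up where "Up = mat n n (\<lambda>(k, j). f k (x j))"
  have G_eq: "?G = Lo * Up"
  proof (rule eq_matI)
    fix i j assume "i < dim_row (Lo * Up)" "j < dim_col (Lo * Up)"
    then have ij: "i < n" "j < n"
      by (simp_all add: Lo_def Up_def)
    note yi = y[OF ij(1)]
    have "Rep_ell2 (?T (unit_ell2 j)) i = y i (S (x j))"
      using ij by (simp add: B_def Rep_finite_ell2 A_unit)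
    also have "\<dots> = (\<Sum>k<n. f k (x j) * y i (g k))"
      using ij(1)
      by (simp add: split y_R bounded_operator_add[OF yi] bounded_operator_sum[OF yi] bounded_operator_scale[OF yi])
    finally show "?G $$ (i, j) = (Lo * Up) $$ (i, j)"
      using ij by (simp add: Lo_def Up_def scalar_prod_def atLeast0LessThan mult.commute)
  qed (simp_all add: Lo_def Up_def)
  have "det Lo = (\<Prod>k<n. y k (g k))"
    by (subst det_lower_triangular[of n]) (auto simp: Lo_def g_lower prod_list_diag_prod atLeast0LessThan)
  moreover have "det Up = 1"
  proof -
    have "det Up = (\<Prod>k<n. f k (x k))"
      by (subst det_upper_triangular[of _ n]) (auto simp: Up_def f_upper prod_list_diag_prod atLeast0LessThan)
    then show ?thesis
      by (simp add: f_diag)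
  qed
  moreover have "det ?G = det Lo * det Up"
    unfolding G_eq by (rule det_mult[of _ n]) (simp_all add: Lo_def Up_def)
  ultimately have G: "norm (det ?G) = (\<Prod>k<n. norm (y k (g k)))"
    by (simp add: prod_norm)
  have "c ^ n = (\<Prod>k<n. c)"
    by simp
  also have "\<dots> \<le> (\<Prod>k<n. norm (y k (g k)))"
    by (rule prod_mono) (use g_diag c(1) in simp)
  also have "\<dots> \<le> (\<Prod>k<n. b k)"
    unfolding G[symmetric] by (rule norm_det_le_prod_approximation_numbers[OF T T_b])
  finally show ?thesis .
qed

text \<open>The \<open>n\<close>th term of the exponential series is at most \<open>e\<^sup>n\<close>.\<close>

lemma power_div_exp_le_fact: "(real n / exp 1) ^ n \<le> fact n"
proof -
  have "(real n ^ n) /\<^sub>R fact n \<le> (\<Sum>k. (real n ^ k) /\<^sub>R fact k)"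
    using sum_le_suminf[OF summable_exp_generic[of "real n"], of "{n}"] by simp
  then have "real n ^ n / fact n \<le> exp (real n)"
    by (simp add: exp_def field_simps)
  moreover have "exp (real n) = exp 1 ^ n"
    by (simp add: exp_of_nat_mult[of n 1, simplified])
  ultimately show ?thesis
    by (simp add: field_simps)
qed

text \<open>
  The factor \<open>n\<^bsup>1-\<alpha>\<^esup>\<close> already bounds the approximation numbers.
\<close>

lemma approximation_number_le_hilbert_numbers:
  fixes sX :: "'k::real_or_complex_field \<Rightarrow> 'a::real_normed_vector \<Rightarrow> 'a"
    and sY :: "'k \<Rightarrow> 'b::real_normed_vector \<Rightarrow> 'b" and S :: "'a \<Rightarrow> 'b" and \<alpha> :: real
  assumes X: "normed_space_over sX" and Y: "normed_space_over sY"
    and S: "bounded_operator sX sY S" and "n \<ge> 1" and "\<alpha> > 0"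
    and M: "\<And>k. 1 \<le> k \<Longrightarrow> k \<le> n \<Longrightarrow> real k powr \<alpha> * hilbert_number sX sY k S \<le> M"
  shows "approximation_number sX sY n S \<le> exp \<alpha> * real n powr (- \<alpha> + 1) * M"
proof (rule ccontr)
  define Q where "Q = exp \<alpha> * real n powr (- \<alpha> + 1)"
  have n: "real n > 0"
    using \<open>n \<ge> 1\<close> by simp
  then have Q: "Q > 0"
    by (simp add: Q_def)
  have "0 \<le> hilbert_number sX sY 1 S"
    by (rule hilbert_number_nonneg[OF X Y S]) simp
  then have M0: "0 \<le> M"
    using M[of 1] \<open>n \<ge> 1\<close> by simp
  assume "\<not> approximation_number sX sY n S \<le> exp \<alpha> * real n powr (- \<alpha> + 1) * M"
  then have "M < approximation_number sX sY n S / Q"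
    using Q by (simp add: Q_def field_simps)
  \<comment> \<open>room for the two strict inequalities required by the determinant estimate\<close>
  then obtain d where d: "M < d" "d < approximation_number sX sY n S / Q"
    using dense by blast
  then obtain e where e: "d < e" "e < approximation_number sX sY n S / Q"
    using dense by blast
  have "0 < d" "0 < e"
    using M0 d e by linarith+
  have "(Q * e) ^ n \<le> (\<Prod>k<n. real n * (d * real (Suc k) powr (- \<alpha>)))"
  proof (rule power_le_prod_hilbert_numbers[OF X Y S \<open>n \<ge> 1\<close>])
    show "0 < Q * e" "Q * e < approximation_number sX sY n S"
      using Q e(2) \<open>0 < e\<close> by (simp_all add: field_simps)
    fix k assume "k < n"
    then have "real (Suc k) powr \<alpha> * hilbert_number sX sY (Suc k) S < d"
      using M[of "Suc k"] d(1) by simp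
    then have "hilbert_number sX sY (Suc k) S < d * real (Suc k) powr (- \<alpha>)"
      by (simp add: powr_minus field_simps)
    then show "real n * hilbert_number sX sY (Suc k) S < real n * (d * real (Suc k) powr (- \<alpha>))"
      using n by simp
  qed
  also have "\<dots> = (real n * d) ^ n * fact n powr (- \<alpha>)"
  proof -
    have "(\<Prod>k<n. real (Suc k) powr (- \<alpha>)) = fact n powr (- \<alpha>)"
      by (simp add: fact_prod_Suc atLeast0LessThan flip: prod_powr_distrib of_nat_Suc)
    then show ?thesis
      by (simp add: prod.distrib mult.assoc[symmetric] power_mult_distrib del: of_nat_Suc)
  qed
  also have "\<dots> \<le> (real n * d) ^ n * (((real n / exp 1) ^ n) powr (- \<alpha>))"
    using n \<open>\<alpha> > 0\<close> \<open>0 < d\<close> by (intro mult_left_mono powr_mono2' power_div_exp_le_fact) auto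
  also have "((real n / exp 1) ^ n) powr (- \<alpha>) = ((real n / exp 1) powr (- \<alpha>)) ^ n"
    using n by (simp add: powr_powr mult.commute flip: powr_realpow)
  also have "(real n * d) ^ n * ((real n / exp 1) powr (- \<alpha>)) ^ n = (Q * d) ^ n"
  proof -
    have "(real n / exp 1) powr (- \<alpha>) = real n powr (- \<alpha>) * exp \<alpha>"
      using n by (simp add: powr_divide powr_def[of "exp 1"] exp_minus field_simps)
    then have *: "real n * d * (real n / exp 1) powr (- \<alpha>) = Q * d"
      using n powr_add[of "real n" "- \<alpha>" 1] by (simp add: Q_def)
    show ?thesis
      by (simp only: power_mult_distrib[symmetric] *)
  qed
  finally have "(Q * e) ^ n \<le> (Q * d) ^ n" .
  then have "Q * e \<le> Q * d"
    using Q \<open>0 < d\<close> \<open>0 < e\<close> \<open>n \<ge> 1\<close> power_mono_iff[of "Q * e" "Q * d" n] by simp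
  then show False
    using Q e(1) by simp
qed

theorem corollary4:
  fixes sX :: "'k::real_or_complex_field \<Rightarrow> 'a::banach \<Rightarrow> 'a"
    and sY :: "'k \<Rightarrow> 'b::banach \<Rightarrow> 'b"
    and S :: "'a \<Rightarrow> 'b" and \<alpha> :: real and n :: nat
  assumes "normed_space_over sX" and "normed_space_over sY"
    and "bounded_operator sX sY S"
    and "\<alpha> > 0" and "n \<ge> 1"
  shows "gelfand_number sX n S \<le> exp \<alpha> * real n powr (- \<alpha> + 1) *
           (SUP k\<in>{1..n}. real k powr \<alpha> * hilbert_number sX sY k S) \<and>
         approximation_number sX sY n S \<le> 2 * exp \<alpha> * real n powr (- \<alpha> + 3 / 2) *
           (SUP k\<in>{1..n}. real k powr \<alpha> * hilbert_number sX sY k S)"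
proof -
  define M where "M = (SUP k\<in>{1..n}. real k powr \<alpha> * hilbert_number sX sY k S)"
  have M: "real k powr \<alpha> * hilbert_number sX sY k S \<le> M" if "1 \<le> k" "k \<le> n" for k
    unfolding M_def using that by (intro cSUP_upper) auto
  have "0 \<le> hilbert_number sX sY 1 S"
    by (rule hilbert_number_nonneg[OF assms(1-3)]) simp
  then have M0: "0 \<le> M"
    using M[of 1] assms(5) by simp
  have a: "approximation_number sX sY n S \<le> exp \<alpha> * real n powr (- \<alpha> + 1) * M"
    by (rule approximation_number_le_hilbert_numbers[OF assms(1-3,5,4) M])
  have "gelfand_number sX n S \<le> approximation_number sX sY n S"
    by (rule gelfand_number_le_approximation_number[OF assms(1-3,5)])
  with a have c: "gelfand_number sX n S \<le> exp \<alpha> * real n powr (- \<alpha> + 1) * M"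
    by linarith
  have "real n powr (- \<alpha> + 1) \<le> 2 * real n powr (- \<alpha> + 3 / 2)"
  proof -
    have "real n powr (- \<alpha> + 1) \<le> real n powr (- \<alpha> + 3 / 2)"
      using assms(5) by (intro powr_mono) auto
    also have "\<dots> \<le> 2 * real n powr (- \<alpha> + 3 / 2)"
      by simp
    finally show ?thesis .
  qed
  then have "exp \<alpha> * real n powr (- \<alpha> + 1) * M \<le> exp \<alpha> * (2 * real n powr (- \<alpha> + 3 / 2)) * M"
    using M0 by (intro mult_right_mono mult_left_mono) auto
  with a have "approximation_number sX sY n S \<le> 2 * exp \<alpha> * real n powr (- \<alpha> + 3 / 2) * M"
    by (simp add: mult_ac)
  with c show ?thesis
    unfolding M_def by blast
qed

end
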